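(* Let $\gamma>0$ and let $L:\mathbb Z^+\to\mathcal L(\mathcal B^\gamma,\mathcal X)$. Assume that there exists $m\in\mathbb Z^-$ such that $\sup_{n\in\mathbb Z^+}\|L(n)P_{[-\infty,m]}\|_{\mathcal B^\gamma\to\mathcal X}<\infty$. If the system $x(n+1)=L(n)x_n+f(n)$, $n\ge0$, is $(\ell^p,\ell^q)$-stable for a certain pair $(p,q)$ with $1\le p\le q\le\infty$ and $(p,q)\neq(1,\infty)$, then it is $(\ell^{p},\ell^{q})$-stable for all pairs $(p,q)$ with $1\le p\le q\le\infty$ and $(p,q)\ne(1,\infty)$.
   Context: $\mathbb Z^+$ and $\mathbb Z^-$ are the sets of nonnegative and nonpositive integers. $(\mathcal X,|\cdot|)$ is a (real or complex) Banach space. $\mathcal X^{\mathbb Z^-}$ is the vector space of all tuples $\varphi=(\varphi^{[m]})_{m\le 0}$ with $\varphi^{[m]}\in\mathcal X$; its zero vector is $0_{\mathcal B}$. For $\gamma\in\mathbb R$, $\mathcal B^\gamma=\{\varphi\in\mathcal X^{\mathbb Z^-}: |\varphi|_{\mathcal B^\gamma}:=\sup_{m\le 0}|\varphi^{[m]}|e^{\gamma m}<\infty\}$. $\mathcal L(\mathcal B^\gamma,\mathcal X)$ is the space of bounded linear operators with operator norm $\|\cdot\|_{\mathcal B^\gamma\to\mathcal X}$. For $1\le p\le\infty$, $\ell^p(\mathcal X)$ is the usual space of $p$-summable (bounded if $p=\infty$) functions $\mathbb Z^+\to\mathcal X$. For $x:\mathbb Z\to\mathcal X$ and $n\in\mathbb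 Z$, the prehistory $x_n\in\mathcal X^{\mathbb Z^-}$ is defined by $x_n^{[m]}=x(n+m)$, $m\le 0$. For $f:\mathbb Z^+\to\mathcal X$, $x(\cdot,0,0_{\mathcal B};f):\mathbb Z\to\mathcal X$ is the unique function $x$ with $x_0=0_{\mathcal B}$ and $x(n+1)=L(n)x_n+f(n)$ for all $n\ge0$. $P_{[-\infty,m]}:\mathcal X^{\mathbb Z^-}\to\mathcal X^{\mathbb Z^-}$ keeps the coordinates with index $\le m$ and replaces all other coordinates by zero. The system is $(\ell^p,\ell^q)$-stable if $x(\cdot,0,0_{\mathcal B};f)$ (restricted to $\mathbb Z^+$) belongs to $\ell^q(\mathcal X)$ for every $f\in\ell^p(\mathcal X)$. *)

theory Defs
  imports "HOL-Analysis.Analysis"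
begin

text \<open>
  The state space is a type of class \<open>banach\<close>, i.e. a real Banach space. A complex Banach space
  is covered by restriction of scalars: complex-linear bounded operators are real-linear, and none
  of the norms below involves the scalar field.

  Tuples indexed by the nonpositive integers are functions \<open>\<phi> :: nat \<Rightarrow> 'a\<close>, where \<open>\<phi> j\<close> is the
  coordinate with index \<open>- j\<close>. So the weight \<open>exp (\<gamma> * m)\<close> at \<open>m = - j\<close> is \<open>exp (- \<gamma> * j)\<close>.
\<close>

definition weighted_space :: "real \<Rightarrow> (nat \<Rightarrow> 'a::real_normed_vector) set" where
  "weighted_space \<gamma> = {\<phi>. bdd_above (range (\<lambda>j. norm (\<phi> j) * exp (- \<gamma> * real j)))}"

definition weighted_norm :: "real \<Rightarrow> (nat \<Rightarrow> 'a::real_normed_vector) \<Rightarrow> real" where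
  "weighted_norm \<gamma> \<phi> = (SUP j. norm (\<phi> j) * exp (- \<gamma> * real j))"

text \<open>
  Operators on the weighted space are functions on all tuples, of which only the values on
  \<open>weighted_space \<gamma>\<close> are relevant.
\<close>

definition bounded_operator ::
    "real \<Rightarrow> ((nat \<Rightarrow> 'a::real_normed_vector) \<Rightarrow> 'a) \<Rightarrow> bool" where
  "bounded_operator \<gamma> T \<longleftrightarrow>
     (\<forall>\<phi>\<in>weighted_space \<gamma>. \<forall>\<psi>\<in>weighted_space \<gamma>. T (\<lambda>j. \<phi> j + \<psi> j) = T \<phi> + T \<psi>) \<and>
     (\<forall>c. \<forall>\<phi>\<in>weighted_space \<gamma>. T (\<lambda>j. c *\<^sub>R \<phi> j) = c *\<^sub>R T \<phi>) \<and>
     (\<exists>K. \<forall>\<phi>\<in>weighted_space \<gamma>. norm (T \<phi>) \<le> K * weighted_norm \<gamma> \<phi>)"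

text \<open>As for \<^const>\<open>onorm\<close>, the zero vector contributes \<open>0 / 0 = 0\<close> to the supremum.\<close>

definition operator_norm ::
    "real \<Rightarrow> ((nat \<Rightarrow> 'a::real_normed_vector) \<Rightarrow> 'a) \<Rightarrow> real" where
  "operator_norm \<gamma> T = (SUP \<phi>\<in>weighted_space \<gamma>. norm (T \<phi>) / weighted_norm \<gamma> \<phi>)"

definition tail_projection :: "int \<Rightarrow> (nat \<Rightarrow> 'a::zero) \<Rightarrow> nat \<Rightarrow> 'a" where
  "tail_projection m \<phi> = (\<lambda>j. if - int j \<le> m then \<phi> j else 0)"

definition prehistory :: "(int \<Rightarrow> 'a) \<Rightarrow> int \<Rightarrow> nat \<Rightarrow> 'a" where
  "prehistory x n = (\<lambda>j. x (n - int j))"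

definition is_zero_state_solution ::
    "(nat \<Rightarrow> (nat \<Rightarrow> 'a::real_normed_vector) \<Rightarrow> 'a) \<Rightarrow> (nat \<Rightarrow> 'a) \<Rightarrow> (int \<Rightarrow> 'a) \<Rightarrow> bool" where
  "is_zero_state_solution L f x \<longleftrightarrow>
     prehistory x 0 = (\<lambda>j. 0) \<and>
     (\<forall>n. x (int n + 1) = L n (prehistory x (int n)) + f n)"

definition zero_state_solution ::
    "(nat \<Rightarrow> (nat \<Rightarrow> 'a::real_normed_vector) \<Rightarrow> 'a) \<Rightarrow> (nat \<Rightarrow> 'a) \<Rightarrow> int \<Rightarrow> 'a" where
  "zero_state_solution L f = (THE x. is_zero_state_solution L f x)"

fun forward_values ::
    "(nat \<Rightarrow> (nat \<Rightarrow> 'a::real_normed_vector) \<Rightarrow> 'a) \<Rightarrow> (nat \<Rightarrow> 'a) \<Rightarrow> nat \<Rightarrow> 'a" where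
  "forward_values L f 0 = 0"
| "forward_values L f (Suc n) =
     L n (\<lambda>j. if j \<le> n then forward_values L f (n - j) else 0) + f n"

lemma ex1_zero_state_solution: "\<exists>!x. is_zero_state_solution L f x"
proof (rule ex_ex1I)
  define x where "x = (\<lambda>k::int. if k \<le> 0 then 0 else forward_values L f (nat k))"
  have pre: "prehistory x (int n) =
      (\<lambda>j. if j \<le> n then forward_values L f (n - j) else 0)" for n
  proof
    fix j
    show "prehistory x (int n) j = (if j \<le> n then forward_values L f (n - j) else 0)"
      by (cases "j < n"; cases "j = n")
         (auto simp: prehistory_def x_def nat_diff_distrib)
  qed
  have "x (int n + 1) = L n (prehistory x (int n)) + f n" for n
    unfolding pre by (simp add: x_def nat_add_distrib)
  moreover have "prehistory x 0 = (\<lambda>j. 0)"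
    by (auto simp: prehistory_def x_def)
  ultimately show "\<exists>x. is_zero_state_solution L f x"
    unfolding is_zero_state_solution_def by blast
next
  fix x y assume x: "is_zero_state_solution L f x" and y: "is_zero_state_solution L f y"
  have neg: "z k = 0" if "is_zero_state_solution L f z" "k \<le> 0" for z k
  proof -
    have "prehistory z 0 (nat (- k)) = 0"
      using that(1) by (simp add: is_zero_state_solution_def)
    with that(2) show ?thesis by (simp add: prehistory_def)
  qed
  have "\<forall>k \<le> int n. x k = y k" for n
  proof (induction n)
    case 0
    then show ?case using neg[OF x] neg[OF y] by simp
  next
    case (Suc n)
    then have "prehistory x (int n) = prehistory y (int n)"
      by (auto simp: prehistory_def)
    then have eq: "x (int n + 1) = y (int n + 1)"
      using x y by (simp add: is_zero_state_solution_def)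
    show ?case
    proof (intro allI impI)
      fix k assume "k \<le> int (Suc n)"
      then consider "k \<le> int n" | "k = int n + 1" by linarith
      then show "x k = y k" using Suc eq by cases auto
    qed
  qed
  then have "x k = y k" for k by (metis nat_le_iff nle_le)
  then show "x = y" by blast
qed

definition in_lp :: "ennreal \<Rightarrow> (nat \<Rightarrow> 'a::real_normed_vector) \<Rightarrow> bool" where
  "in_lp p f \<longleftrightarrow>
     (if p = \<infinity> then bounded (range f) else summable (\<lambda>n. norm (f n) powr enn2real p))"

definition lp_lq_stable ::
    "(nat \<Rightarrow> (nat \<Rightarrow> 'a::real_normed_vector) \<Rightarrow> 'a) \<Rightarrow> ennreal \<Rightarrow> ennreal \<Rightarrow> bool" where
  "lp_lq_stable L p q \<longleftrightarrow>
     (\<forall>f. in_lp p f \<longrightarrow> in_lp q (\<lambda>n. zero_state_solution L f (int n)))"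

end

theory Submission
  imports Defs "HOL-Probability.Discrete_Topology"
begin

text \<open>
  By uniform boundedness, stability bounds the zero state solution in terms of its forcing. Applied
  to impulses, this bounds the action of \<open>L n\<close> on the most recent coordinates uniformly in \<open>n\<close>,
  and hence \<open>L n\<close> itself. Since \<open>\<gamma> > 0\<close>, the forcing produced by an initial history decays
  exponentially, so homogeneous solutions are controlled by the weighted norm of their history. If
  \<open>q < \<infinity>\<close>, Datko's argument makes them decay; if \<open>q = \<infinity>\<close> and \<open>p > 1\<close>, multiplication by a ramp
  of length \<open>N\<close> does, as its forcing is \<open>O(1 / N)\<close> on \<open>N\<close> steps. Either way the decay is
  uniform, hence exponential, and convolution with a geometric kernel maps every \<open>\<ell>\<^sup>p\<close> into itself
  and so into \<open>\<ell>\<^sup>q\<close> for \<open>q \<ge> p\<close>.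
\<close>

text \<open>The hypothesis controls \<open>L n\<close> uniformly only on old coordinates; the recent
  ones have to be recovered from stability. Stability sees only reachable histories: the state is
  zero at time 0, so a history at time n vanishes at every index \<open>j \<ge> n\<close>. Hence the
  uniform bound on \<open>L n\<close> is proved, and used, only for vectors with that support, and
  homogeneous solutions are required to vanish at time 0. The link between homogeneous and forced
  problems is that a sequence starting at zero solves the system with its own defect as forcing.
  Cutting a homogeneous solution off and multiplying it by a ramp are two ways to produce such a
  defect. Since the sequence spaces are nested, every admissible pair weakens to
  \<open>(1, q)\<close> with q finite or to \<open>(r, \<infinity>)\<close> with
  \<open>1 < r\<close> finite, one for each decay argument. The pair \<open>(1, \<infinity>)\<close>
  gives boundedness without decay: for \<open>L n \<phi> = \<phi> 0\<close> the solution is the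
  running sum of the forcing. In the ramp argument this shows as the cost N^(1/p - 1), which tends
  to 0 only for \<open>p > 1\<close>.\<close>

text \<open>Baire category: a closed sublevel set contains a ball, \<open>diff\<close> moves its
  centre to the origin and \<open>hom\<close> rescales it. The degree \<open>r\<close> and the
  constant \<open>K\<close> are free because q-th power sums are homogeneous of degree q and
  subadditive only up to a constant.\<close>

lemma uniform_boundedness_seminorms:
  fixes \<phi> :: "'i \<Rightarrow> 'e::{real_normed_vector,complete_space} \<Rightarrow> real"
  assumes cont: "\<And>i. continuous_on UNIV (\<phi> i)"
    and diff: "\<And>i a b. \<phi> i (a - b) \<le> K * (\<phi> i a + \<phi> i b)"
    and hom: "\<And>i c a. c > 0 \<Longrightarrow> \<phi> i (c *\<^sub>R a) = c powr r * \<phi> i a"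
    and bdd: "\<And>a. \<exists>B. \<forall>i. \<phi> i a \<le> B"
    and K: "K \<ge> 0"
  shows "\<exists>C. \<forall>i a. norm a \<le> 1 \<longrightarrow> \<phi> i a \<le> C"
proof -
  define F where "F = (\<lambda>k::nat. {a. \<forall>i. \<phi> i a \<le> real k})"
  have cl: "closed (F k)" for k
  proof -
    have "F k = (\<Inter>i. {a. \<phi> i a \<le> real k})"
      by (auto simp: F_def)
    moreover have "closed {a. \<phi> i a \<le> real k}" for i
      by (intro closed_Collect_le cont continuous_intros)
    ultimately show ?thesis by auto
  qed
  have un: "(\<Union>k. F k) = UNIV"
  proof -
    have "\<exists>k. a \<in> F k" for a
    proof -
      obtain B where B: "\<And>i. \<phi> i a \<le> B" using bdd by blast
      obtain k where "B \<le> real k" using real_arch_simple by blast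
      then have "\<forall>i. \<phi> i a \<le> real k" using B order_trans by blast
      then show ?thesis by (auto simp: F_def)
    qed
    then show ?thesis by auto
  qed
  have "\<exists>k. interior (F k) \<noteq> {}"
  proof (rule ccontr)
    assume "\<not> ?thesis"
    then have "interior (\<Union>(range F)) = {}"
      using Baire_category_alt[of "euclidean :: 'e topology" "range F"] cl
      by (auto simp: completely_metrizable_space_euclidean)
    then show False using un by simp
  qed
  then obtain k a0 where "a0 \<in> interior (F k)" by blast
  then obtain e where e: "e > 0" "cball a0 e \<subseteq> F k"
    by (meson interior_subset mem_interior_cball)
  have "\<phi> i a \<le> 2 * K * real k / e powr r" if "norm a \<le> 1" for i a
  proof -
    \<comment> \<open>The difference of these two points of the ball is
      \<open>e *\<^sub>R a\<close>.\<close>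
    have "a0 + e *\<^sub>R a \<in> F k" "a0 \<in> F k"
      using e that by (auto simp: subset_iff dist_norm)
    then have "\<phi> i (a0 + e *\<^sub>R a) \<le> real k" "\<phi> i a0 \<le> real k"
      by (auto simp: F_def)
    then have "K * (\<phi> i (a0 + e *\<^sub>R a) + \<phi> i a0) \<le> K * (real k + real k)"
      using K by (intro mult_left_mono add_mono) auto
    then have "e powr r * \<phi> i a \<le> 2 * K * real k"
      using diff[of i "a0 + e *\<^sub>R a" a0] hom[of e i a] e by simp
    then show ?thesis using e by (simp add: field_simps)
  qed
  then show ?thesis by blast
qed

section \<open>Histories and zero state solutions on the natural numbers\<close>

text \<open>The \<open>prehistory\<close> at time \<open>n\<close> of the sequence \<open>u\<close>
  extended by zero to negative times.\<close>

definition history :: "(nat \<Rightarrow> 'a::zero) \<Rightarrow> nat \<Rightarrow> nat \<Rightarrow> 'a" where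
  "history u n = (\<lambda>j. if j \<le> n then u (n - j) else 0)"

definition impulse :: "nat \<Rightarrow> 'a::zero \<Rightarrow> nat \<Rightarrow> 'a" where
  "impulse k v = (\<lambda>n. if n = k then v else 0)"

lemma weighted_space_finite_support:
  assumes "\<And>j. j > n \<Longrightarrow> \<phi> j = 0"
  shows "\<phi> \<in> weighted_space \<gamma>"
proof -
  have "range (\<lambda>j. norm (\<phi> j) * exp (- \<gamma> * real j))
      \<subseteq> insert 0 ((\<lambda>j. norm (\<phi> j) * exp (- \<gamma> * real j)) ` {..n})"
  proof
    fix y assume "y \<in> range (\<lambda>j. norm (\<phi> j) * exp (- \<gamma> * real j))"
    then obtain j where "y = norm (\<phi> j) * exp (- \<gamma> * real j)" by blast
    then show "y \<in> insert 0 ((\<lambda>j. norm (\<phi> j) * exp (- \<gamma> * real j)) ` {..n})"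
      using assms[of j] by (cases "j \<le> n") auto
  qed
  then have "bdd_above (range (\<lambda>j. norm (\<phi> j) * exp (- \<gamma> * real j)))"
    by (rule bdd_above_mono[rotated]) simp
  then show ?thesis
    unfolding weighted_space_def by simp
qed

lemma weighted_norm_le:
  assumes "\<And>j. norm (\<phi> j) * exp (- \<gamma> * real j) \<le> c"
  shows "weighted_norm \<gamma> \<phi> \<le> c"
  unfolding weighted_norm_def using assms by (intro cSUP_least) auto

lemma weighted_norm_upper:
  assumes "\<phi> \<in> weighted_space \<gamma>"
  shows "norm (\<phi> j) * exp (- \<gamma> * real j) \<le> weighted_norm \<gamma> \<phi>"
  using assms unfolding weighted_norm_def weighted_space_def by (auto intro: cSUP_upper)

lemma weighted_norm_nonneg: "\<phi> \<in> weighted_space \<gamma> \<Longrightarrow> 0 \<le> weighted_norm \<gamma> \<phi>"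
  using weighted_norm_upper[of \<phi> \<gamma> 0] order_trans[OF norm_ge_zero] by simp

lemma history_weighted: "history u n \<in> weighted_space \<gamma>"
  by (rule weighted_space_finite_support[of n]) (simp add: history_def)

lemma history_cong: "(\<And>i. i \<le> n \<Longrightarrow> u i = v i) \<Longrightarrow> history u n = history v n"
  by (auto simp: history_def)

lemma forward_values_Suc:
  "forward_values L f (Suc n) = L n (history (forward_values L f) n) + f n"
  by (simp add: history_def)

declare forward_values.simps(2) [simp del]

lemma zero_state_solution_nat: "zero_state_solution L f (int n) = forward_values L f n"
proof -
  define x where "x = zero_state_solution L f"
  have x: "is_zero_state_solution L f x"
    unfolding x_def zero_state_solution_def using ex1_zero_state_solution by (rule theI')
  have neg: "x k = 0" if "k \<le> 0" for k
  proof -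
    have "prehistory x 0 (nat (- k)) = 0"
      using x by (simp add: is_zero_state_solution_def)
    with that show ?thesis by (simp add: prehistory_def)
  qed
  have "x (int n) = forward_values L f n"
  proof (induction n rule: less_induct)
    case (less n)
    show ?case
    proof (cases n)
      case 0
      then show ?thesis by (simp add: neg)
    next
      case (Suc m)
      have "prehistory x (int m) j = history (forward_values L f) m j" for j
        using less.IH[of "m - j"] Suc
        by (cases "j \<le> m") (auto simp: prehistory_def history_def neg of_nat_diff)
      then have "prehistory x (int m) = history (forward_values L f) m" ..
      moreover have "x (int m + 1) = L m (prehistory x (int m)) + f m"
        using x by (simp add: is_zero_state_solution_def)
      ultimately show ?thesis
        by (simp add: forward_values_Suc Suc add.commute)
    qed
  qed
  then show ?thesis by (simp add: x_def)
qed

lemma forward_values_cong: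
  "(\<And>k. k < n \<Longrightarrow> f k = g k) \<Longrightarrow> forward_values L f n = forward_values L g n"
proof (induction n rule: less_induct)
  case (less n)
  show ?case
  proof (cases n)
    case (Suc m)
    have "history (forward_values L f) m = history (forward_values L g) m"
      using less Suc by (intro history_cong) auto
    then show ?thesis using less.prems Suc by (simp add: forward_values_Suc)
  qed simp
qed

text \<open>Makes a forced solution out of any sequence starting at zero. Truncated and ramped
  homogeneous solutions come under the stability bounds in this way.\<close>

lemma forward_values_residual:
  assumes "u 0 = 0" "\<And>k. k < n \<Longrightarrow> f k = u (Suc k) - L k (history u k)"
  shows "forward_values L f n = u n"
  using assms(2)
proof (induction n rule: less_induct)
  case (less n)
  show ?case
  proof (cases n)
    case 0
    then show ?thesis by (simp add: assms)
  next
    case (Suc m)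
    have "history (forward_values L f) m = history u m"
      using less Suc by (intro history_cong) auto
    then show ?thesis using less.prems[of m] Suc by (simp add: forward_values_Suc)
  qed
qed

section \<open>Linearity and superposition\<close>

locale delay_system =
  fixes \<gamma> :: real and L :: "nat \<Rightarrow> (nat \<Rightarrow> 'a::banach) \<Rightarrow> 'a"
  assumes gamma_pos: "\<gamma> > 0" and bounded_operator: "bounded_operator \<gamma> (L n)"
begin

abbreviation "fv \<equiv> forward_values L"

lemma L_add:
  "\<phi> \<in> weighted_space \<gamma> \<Longrightarrow> \<psi> \<in> weighted_space \<gamma> \<Longrightarrow> L n (\<lambda>j. \<phi> j + \<psi> j) = L n \<phi> + L n \<psi>"
  using bounded_operator[of n] by (simp add: bounded_operator_def)

lemma L_scaleR: "\<phi> \<in> weighted_space \<gamma> \<Longrightarrow> L n (\<lambda>j. c *\<^sub>R \<phi> j) = c *\<^sub>R L n \<phi>"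
  using bounded_operator[of n] by (simp add: bounded_operator_def)

lemma L_zero: "L n (\<lambda>j. 0) = 0"
  using L_scaleR[of "\<lambda>j. 0" n 0] weighted_space_finite_support[of 0 "\<lambda>j. 0 :: 'a"] by simp

lemma L_diff:
  assumes "\<phi> \<in> weighted_space \<gamma>" "\<psi> \<in> weighted_space \<gamma>"
  shows "L n (\<lambda>j. \<phi> j - \<psi> j) = L n \<phi> - L n \<psi>"
proof -
  have "(\<lambda>j. (-1) *\<^sub>R \<psi> j) \<in> weighted_space \<gamma>"
    using assms(2) by (simp add: weighted_space_def)
  then show ?thesis
    using L_add[of \<phi> "\<lambda>j. (-1) *\<^sub>R \<psi> j" n] L_scaleR[of \<psi> n "-1"] assms by simp
qed

lemma L_bound: "\<exists>K\<ge>0. \<forall>\<phi>\<in>weighted_space \<gamma>. norm (L n \<phi>) \<le> K * weighted_norm \<gamma> \<phi>"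
proof -
  obtain K where K: "\<And>\<phi>. \<phi>\<in>weighted_space \<gamma> \<Longrightarrow> norm (L n \<phi>) \<le> K * weighted_norm \<gamma> \<phi>"
    using bounded_operator[of n] unfolding bounded_operator_def by blast
  have "norm (L n \<phi>) \<le> \<bar>K\<bar> * weighted_norm \<gamma> \<phi>" if "\<phi>\<in>weighted_space \<gamma>" for \<phi>
    using K[OF that] mult_right_mono[OF abs_ge_self[of K] weighted_norm_nonneg[OF that]] by linarith
  then show ?thesis by (intro exI[of _ "\<bar>K\<bar>"]) auto
qed

lemma fv_add: "fv (\<lambda>k. f k + g k) n = fv f n + fv g n"
proof (induction n rule: less_induct)
  case (less n)
  show ?case
  proof (cases n)
    case (Suc m)
    have "history (fv (\<lambda>k. f k + g k)) m = (\<lambda>j. history (fv f) m j + history (fv g) m j)"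
      using less Suc by (auto simp: history_def)
    then show ?thesis
      by (simp add: Suc forward_values_Suc L_add history_weighted)
  qed simp
qed

lemma fv_scaleR: "fv (\<lambda>k. c *\<^sub>R f k) n = c *\<^sub>R fv f n"
proof (induction n rule: less_induct)
  case (less n)
  show ?case
  proof (cases n)
    case (Suc m)
    have "history (fv (\<lambda>k. c *\<^sub>R f k)) m = (\<lambda>j. c *\<^sub>R history (fv f) m j)"
      using less Suc by (auto simp: history_def)
    then show ?thesis
      by (simp add: Suc forward_values_Suc L_scaleR history_weighted scaleR_add_right)
  qed simp
qed

lemma fv_zero: "fv (\<lambda>k. 0) n = 0"
  using fv_scaleR[of 0 "\<lambda>k. 0" n] by simp

lemma fv_sum: "finite A \<Longrightarrow> fv (\<lambda>k. \<Sum>i\<in>A. f i k) n = (\<Sum>i\<in>A. fv (f i) n)"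
  by (induction A rule: finite_induct) (auto simp: fv_add fv_zero)

lemma fv_impulses: "fv f n = (\<Sum>k<n. fv (impulse k (f k)) n)"
proof -
  have "fv f n = fv (\<lambda>k. \<Sum>i<n. impulse i (f i) k) n"
    by (rule forward_values_cong) (simp add: impulse_def)
  then show ?thesis by (simp add: fv_sum)
qed

text \<open>The constant depends on \<open>n\<close>, since nothing uniform is known about
  \<open>L n\<close> yet; it only serves to make evaluation at time \<open>n\<close>
  continuous.\<close>

lemma fv_bound: "\<exists>D\<ge>0. \<forall>f c. (\<forall>k<n. norm (f k) \<le> c) \<longrightarrow> c \<ge> 0 \<longrightarrow> norm (fv f n) \<le> D * c"
proof (induction n rule: less_induct)
  case (less n)
  show ?case
  proof (cases n)
    case 0
    then show ?thesis by (intro exI[of _ 0]) auto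
  next
    case (Suc m)
    obtain D where D: "\<And>i. i < n \<Longrightarrow> D i \<ge> 0"
      "\<And>i f c. i < n \<Longrightarrow> (\<forall>k<i. norm (f k) \<le> c) \<Longrightarrow> c \<ge> 0 \<Longrightarrow> norm (fv f i) \<le> D i * c"
      using less.IH by metis
    define E where "E = (\<Sum>i<n. D i)"
    have E: "D i \<le> E" if "i < n" for i
      unfolding E_def using that D by (intro member_le_sum) auto
    then have E0: "E \<ge> 0" using D(1)[of 0] E[of 0] Suc by linarith
    obtain K where K: "K \<ge> 0" "\<And>\<phi>. \<phi> \<in> weighted_space \<gamma> \<Longrightarrow> norm (L m \<phi>) \<le> K * weighted_norm \<gamma> \<phi>"
      using L_bound by blast
    have "norm (fv f n) \<le> (K * E + 1) * c" if f: "\<forall>k<n. norm (f k) \<le> c" "c \<ge> 0" for f c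
    proof -
      have "norm (fv f i) \<le> E * c" if "i < n" for i
        using D(2)[of i f c] E[OF that] f that mult_right_mono[of "D i" E c] by fastforce
      then have h: "norm (history (fv f) m j) \<le> E * c" for j
        using Suc E0 f by (auto simp: history_def)
      have "norm (history (fv f) m j) * exp (- \<gamma> * real j) \<le> E * c" for j
      proof -
        have "norm (history (fv f) m j) * exp (- \<gamma> * real j) \<le> norm (history (fv f) m j) * 1"
          using gamma_pos by (intro mult_left_mono) auto
        then show ?thesis using h[of j] by simp
      qed
      then have "weighted_norm \<gamma> (history (fv f) m) \<le> E * c"
        by (rule weighted_norm_le)
      then have "norm (L m (history (fv f) m)) \<le> K * (E * c)"
        using K(2)[OF history_weighted] mult_left_mono[OF _ K(1)] order_trans by blast
      moreover have "norm (f m) \<le> c" using f Suc by simp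
      moreover have "norm (fv f n) \<le> norm (L m (history (fv f) m)) + norm (f m)"
        by (simp add: Suc forward_values_Suc norm_triangle_ineq)
      ultimately show ?thesis by (simp add: algebra_simps)
    qed
    then show ?thesis using K E0 by (intro exI[of _ "K * E + 1"]) auto
  qed
qed

section \<open>From stability to uniform bounds on solutions\<close>

text \<open>Bounded continuous functions on the discrete naturals are the bounded sequences.
  Multiplying them by \<open>w\<close> gives exactly the forcings dominated by a multiple of
  \<open>w\<close>.\<close>

lemma fv_weighted_bounded_linear:
  assumes w: "\<And>k. w k \<ge> 0"
  shows "bounded_linear (\<lambda>g :: nat discrete \<Rightarrow>\<^sub>C 'a. fv (\<lambda>k. w k *\<^sub>R apply_bcontfun g (discrete k)) n)"
proof -
  obtain D where D: "D \<ge> 0" "\<And>f c. (\<forall>k<n. norm (f k) \<le> c) \<Longrightarrow> c \<ge> 0 \<Longrightarrow> norm (fv f n) \<le> D * c"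
    using fv_bound by blast
  define W where "W = (\<Sum>k<n. w k)"
  have W: "w k \<le> W" if "k < n" for k
    unfolding W_def using that w by (intro member_le_sum) auto
  have W0: "W \<ge> 0" unfolding W_def using w by (intro sum_nonneg) auto
  show ?thesis
  proof (rule bounded_linear_intro[where K = "D * W"])
    fix g h :: "nat discrete \<Rightarrow>\<^sub>C 'a" and c :: real
    show "fv (\<lambda>k. w k *\<^sub>R apply_bcontfun (g + h) (discrete k)) n
        = fv (\<lambda>k. w k *\<^sub>R apply_bcontfun g (discrete k)) n + fv (\<lambda>k. w k *\<^sub>R apply_bcontfun h (discrete k)) n"
      by (simp add: scaleR_add_right fv_add)
    show "fv (\<lambda>k. w k *\<^sub>R apply_bcontfun (c *\<^sub>R g) (discrete k)) n
        = c *\<^sub>R fv (\<lambda>k. w k *\<^sub>R apply_bcontfun g (discrete k)) n"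
      by (simp add: fv_scaleR[symmetric] mult.commute)
    have "\<forall>k<n. norm (w k *\<^sub>R apply_bcontfun g (discrete k)) \<le> W * norm g"
      using W w norm_bounded[of g] W0 by (auto intro!: mult_mono)
    then have "norm (fv (\<lambda>k. w k *\<^sub>R apply_bcontfun g (discrete k)) n) \<le> D * (W * norm g)"
      using D(2) W0 by simp
    then show "norm (fv (\<lambda>k. w k *\<^sub>R apply_bcontfun g (discrete k)) n) \<le> norm g * (D * W)"
      by (simp add: ac_simps)
  qed
qed

text \<open>
  \<open>\<Phi>\<close> stands for \<open>\<lambda>T u. norm (u T)\<close> or \<open>\<lambda>T u. \<Sum>i\<le>T. norm (u i) powr q\<close>. A sequence of forcings refuting a uniform bound is
  dominated by multiples of one weight in \<open>\<ell>\<^sup>p\<close>, so that uniform boundedness is only needed on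
  the Banach space of bounded sequences.
\<close>

lemma uniform_bound_of_stability:
  fixes \<Phi> :: "nat \<Rightarrow> (nat \<Rightarrow> 'a) \<Rightarrow> real"
  assumes p: "p \<ge> 1"
    and cont: "\<And>T (h :: nat \<Rightarrow> (nat discrete \<Rightarrow>\<^sub>C 'a) \<Rightarrow> 'a). (\<And>n. continuous_on UNIV (h n)) \<Longrightarrow>
          continuous_on UNIV (\<lambda>g. \<Phi> T (\<lambda>n. h n g))"
    and diff: "\<And>T a b. \<Phi> T (\<lambda>n. a n - b n) \<le> K * (\<Phi> T a + \<Phi> T b)"
    and hom: "\<And>T c a. c > 0 \<Longrightarrow> \<Phi> T (\<lambda>n. c *\<^sub>R a n) = c powr r * \<Phi> T a"
    and causal: "\<And>T a b. (\<And>i. i \<le> T \<Longrightarrow> a i = b i) \<Longrightarrow> \<Phi> T a = \<Phi> T b"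
    and K: "K \<ge> 0"
    and stable: "\<And>f. summable (\<lambda>n. norm (f n) powr p) \<Longrightarrow> \<exists>B. \<forall>T. \<Phi> T (fv f) \<le> B"
  shows "\<exists>C. \<forall>f T. (\<Sum>k<T. norm (f k) powr p) \<le> 1 \<longrightarrow> \<Phi> T (fv f) \<le> C"
proof (rule ccontr)
  assume "\<not> ?thesis"
  then have "\<forall>C. \<exists>f T. (\<Sum>k<T. norm (f k) powr p) \<le> 1 \<and> \<Phi> T (fv f) > C"
    by (meson not_le)
  \<comment> \<open>The threshold is fitted to the end of the proof: \<open>F i\<close> will be at
    most \<open>2 ^ i\<close> times the weight, and this factor leaves \<open>\<Phi>\<close> as
    \<open>(2 ^ i) powr r\<close>, so that \<open>real i < C\<close> remains.\<close>
  then have "\<forall>i::nat. \<exists>f T. (\<Sum>k<T. norm (f k) powr p) \<le> 1 \<and> \<Phi> T (fv f) > real i * (2 ^ i) powr r"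
    by blast
  then obtain f T where f: "\<And>i. (\<Sum>k<T i. norm (f i k) powr p) \<le> 1"
      "\<And>i::nat. \<Phi> (T i) (fv (f i)) > real i * (2 ^ i) powr r"
    by metis
  define F where "F = (\<lambda>i k. if k < T i then f i k else 0)"
  have F_sum: "(\<Sum>k<J. norm (F i k) powr p) \<le> 1" for i J
  proof -
    have "(\<Sum>k<J. norm (F i k) powr p) = (\<Sum>k\<in>{..<J} \<inter> {..<T i}. norm (f i k) powr p)"
      by (rule sum.mono_neutral_cong_right) (auto simp: F_def)
    also have "\<dots> \<le> (\<Sum>k<T i. norm (f i k) powr p)"
      by (rule sum_mono2) auto
    finally show ?thesis using f(1)[of i] by simp
  qed
  have F_le: "norm (F i k) powr p \<le> 1" for i k
    using F_sum[of i "Suc k"] sum_nonneg[of "{..<k}" "\<lambda>k. norm (F i k) powr p"] by simp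
  \<comment> \<open>The geometric factors keep the total of \<open>v\<close> at most 2, because each
    \<open>F i\<close> has p-th power sum at most 1, while a multiple of \<open>v\<close> still
    dominates each p-th power.\<close>
  define v where "v = (\<lambda>k. \<Sum>i. (1/2) ^ i * norm (F i k) powr p)"
  have half: "summable (\<lambda>i. (1/2::real) ^ i)" by (simp add: summable_geometric)
  have sm: "summable (\<lambda>i. (1/2) ^ i * norm (F i k) powr p)" for k
    using F_le[of _ k] by (intro summable_comparison_test'[OF half, of 0]) (auto intro!: mult_left_le)
  have v0: "v k \<ge> 0" for k
    unfolding v_def by (intro suminf_nonneg sm) auto
  have v_ge: "(1/2) ^ i * norm (F i k) powr p \<le> v k" for i k
    unfolding v_def using sum_le_suminf[OF sm, of "{i}" k] by simp
  have "(\<Sum>k<J. v k) \<le> 2" for J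
  proof -
    have "(\<Sum>k<J. v k) = (\<Sum>i. \<Sum>k<J. (1/2) ^ i * norm (F i k) powr p)"
      unfolding v_def by (rule suminf_sum[symmetric]) (rule sm)
    also have "\<dots> \<le> (\<Sum>i. (1/2) ^ i)"
    proof (rule suminf_le)
      show "(\<Sum>k<J. (1/2) ^ i * norm (F i k) powr p) \<le> (1/2) ^ i" for i
        using F_sum[of i J] by (auto simp: sum_distrib_left[symmetric] intro!: mult_left_le)
      show "summable (\<lambda>i. \<Sum>k<J. (1/2) ^ i * norm (F i k) powr p)"
        by (intro summable_sum sm)
    qed (rule half)
    also have "\<dots> = 2" by (simp add: suminf_geometric)
    finally show ?thesis .
  qed
  then have v_summable: "summable v"
    using v0 by (intro bounded_imp_summable[where B = 2])
      (auto simp: lessThan_Suc_atMost[symmetric] simp del: sum.lessThan_Suc)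
  define w where "w = (\<lambda>k. v k powr (1 / p))"
  have w0: "w k \<ge> 0" for k by (simp add: w_def)
  have wp: "w k powr p = v k" for k
    using p v0 by (simp add: w_def powr_powr)
  have F_w: "norm (F i k) \<le> 2 ^ i * w k" for i k
  proof -
    have "norm (F i k) powr p \<le> 2 ^ i * v k"
      using v_ge[of i k] by (simp add: power_divide field_simps)
    also have "\<dots> \<le> (2 ^ i) powr p * v k"
      using v0 p powr_mono[of 1 p "2 ^ i :: real"] by (intro mult_right_mono) auto
    also have "\<dots> = (2 ^ i * w k) powr p"
      using w0 by (simp add: powr_mult wp)
    finally show ?thesis
      using powr_less_mono2[of p "2 ^ i * w k" "norm (F i k)"] p w0[of k] by fastforce
  qed
  have lin: "bounded_linear (\<lambda>g :: nat discrete \<Rightarrow>\<^sub>C 'a. fv (\<lambda>k. w k *\<^sub>R apply_bcontfun g (discrete k)) n)" for n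
    by (rule fv_weighted_bounded_linear) (rule w0)
  have "\<exists>C. \<forall>T (g :: nat discrete \<Rightarrow>\<^sub>C 'a). norm g \<le> 1 \<longrightarrow> \<Phi> T (fv (\<lambda>k. w k *\<^sub>R apply_bcontfun g (discrete k))) \<le> C"
  proof (rule uniform_boundedness_seminorms[where K = K and r = r
        and \<phi> = "\<lambda>T (g :: nat discrete \<Rightarrow>\<^sub>C 'a). \<Phi> T (fv (\<lambda>k. w k *\<^sub>R apply_bcontfun g (discrete k)))"])
    fix T and g h :: "nat discrete \<Rightarrow>\<^sub>C 'a" and c :: real
    show "continuous_on UNIV (\<lambda>g :: nat discrete \<Rightarrow>\<^sub>C 'a. \<Phi> T (fv (\<lambda>k. w k *\<^sub>R apply_bcontfun g (discrete k))))"
      using cont[of "\<lambda>n g. fv (\<lambda>k. w k *\<^sub>R apply_bcontfun g (discrete k)) n" T]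
        linear_continuous_on[OF lin] by simp
    have "fv (\<lambda>k. w k *\<^sub>R apply_bcontfun (g - h) (discrete k))
        = (\<lambda>n. fv (\<lambda>k. w k *\<^sub>R apply_bcontfun g (discrete k)) n - fv (\<lambda>k. w k *\<^sub>R apply_bcontfun h (discrete k)) n)"
      using bounded_linear.linear[OF lin] linear_diff by blast
    then show "\<Phi> T (fv (\<lambda>k. w k *\<^sub>R apply_bcontfun (g - h) (discrete k)))
        \<le> K * (\<Phi> T (fv (\<lambda>k. w k *\<^sub>R apply_bcontfun g (discrete k))) + \<Phi> T (fv (\<lambda>k. w k *\<^sub>R apply_bcontfun h (discrete k))))"
      using diff by simp
    have "fv (\<lambda>k. w k *\<^sub>R apply_bcontfun (c *\<^sub>R g) (discrete k))
        = (\<lambda>n. c *\<^sub>R fv (\<lambda>k. w k *\<^sub>R apply_bcontfun g (discrete k)) n)"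
      using bounded_linear.linear[OF lin] linear_scale by blast
    then show "\<Phi> T (fv (\<lambda>k. w k *\<^sub>R apply_bcontfun (c *\<^sub>R g) (discrete k)))
        = c powr r * \<Phi> T (fv (\<lambda>k. w k *\<^sub>R apply_bcontfun g (discrete k)))" if "c > 0"
      using hom[OF that] by simp
    show "\<exists>B. \<forall>T. \<Phi> T (fv (\<lambda>k. w k *\<^sub>R apply_bcontfun g (discrete k))) \<le> B"
    proof (rule stable, rule summable_comparison_test'[of _ 0])
      show "summable (\<lambda>k. norm g powr p * v k)"
        using v_summable by (rule summable_mult)
      show "norm (norm (w k *\<^sub>R apply_bcontfun g (discrete k)) powr p) \<le> norm g powr p * v k" for k
        using w0[of k] wp[of k] v0[of k] p norm_bounded[of g "discrete k"]
        by (auto simp: powr_mult mult.commute intro!: mult_left_mono powr_mono2)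
    qed
  qed (rule K)
  then obtain C where C: "\<And>T (g :: nat discrete \<Rightarrow>\<^sub>C 'a). norm g \<le> 1 \<Longrightarrow> \<Phi> T (fv (\<lambda>k. w k *\<^sub>R apply_bcontfun g (discrete k))) \<le> C"
    by blast
  have "real i < C" for i
  proof -
    \<comment> \<open>Where \<open>w k = 0\<close>, \<open>F_w\<close> forces
      \<open>F i k = 0\<close>, so the value 0 of the quotient does no harm.\<close>
    define h where "h = (\<lambda>k. (1 / (2 ^ i * w k)) *\<^sub>R F i k)"
    define g where "g = Bcontfun (\<lambda>x. h (of_discrete x))"
    have le: "norm (h k) \<le> 1" for k
      using F_w[of i k] w0[of k] by (cases "w k = 0") (auto simp: h_def field_simps)
    then have app: "apply_bcontfun g = (\<lambda>x. h (of_discrete x))"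
      unfolding g_def
      by (intro Bcontfun_inverse bcontfun_normI[where b = 1])
        (auto simp: continuous_on_open_vimage open_discrete)
    have "norm g \<le> 1"
      using le by (intro norm_bound) (simp add: app)
    then have "\<Phi> (T i) (fv (\<lambda>k. w k *\<^sub>R apply_bcontfun g (discrete k))) \<le> C"
      by (rule C)
    moreover have "F i k = 2 ^ i *\<^sub>R (w k *\<^sub>R apply_bcontfun g (discrete k))" for k
      using F_w[of i k] by (cases "w k = 0") (auto simp: app h_def discrete_inverse)
    then have "fv (F i) = (\<lambda>n. 2 ^ i *\<^sub>R fv (\<lambda>k. w k *\<^sub>R apply_bcontfun g (discrete k)) n)"
      by (auto simp: fv_scaleR[symmetric] cong: forward_values_cong)
    \<comment> \<open>Cutting \<open>f i\<close> off at \<open>T i\<close> changes no solution value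
      up to time \<open>T i\<close>.\<close>
    moreover have "\<Phi> (T i) (fv (F i)) = \<Phi> (T i) (fv (f i))"
      by (intro causal forward_values_cong) (auto simp: F_def)
    ultimately have "\<Phi> (T i) (fv (f i)) \<le> (2 ^ i) powr r * C"
      using hom[of "2 ^ i" "T i" "fv (\<lambda>k. w k *\<^sub>R apply_bcontfun g (discrete k))"]
        mult_left_mono[of _ C "(2 ^ i) powr r"] by (metis powr_ge_zero zero_less_numeral zero_less_power)
    then have "real i * (2 ^ i) powr r < C * (2 ^ i) powr r"
      using f(2)[of i] by (metis less_le_trans mult.commute)
    then show ?thesis by (rule mult_right_less_imp_less) simp
  qed
  then show False using reals_Archimedean2 by (metis less_asym)
qed

end

lemma powr_add_le:
  fixes a b q :: real
  assumes "a \<ge> 0" "b \<ge> 0" "q \<ge> 0"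
  shows "(a + b) powr q \<le> 2 powr q * (a powr q + b powr q)"
proof -
  have "(a + b) powr q \<le> (2 * max a b) powr q"
    using assms by (intro powr_mono2) auto
  also have "\<dots> = 2 powr q * max a b powr q"
    using assms by (simp add: powr_mult)
  also have "\<dots> \<le> 2 powr q * (a powr q + b powr q)"
    by (intro mult_left_mono) (auto simp: max_def)
  finally show ?thesis .
qed

context delay_system
begin

text \<open>The bound on the unit ball is made homogeneous by scaling; by causality only the forcing
  before time \<open>n\<close> counts.\<close>

lemma sup_bound_of_stability:
  assumes p: "p \<ge> 1"
    and stable: "\<And>f. summable (\<lambda>n. norm (f n) powr p) \<Longrightarrow> bounded (range (fv f))"
  shows "\<exists>C\<ge>0. \<forall>f n. norm (fv f n) \<le> C * (\<Sum>k<n. norm (f k) powr p) powr (1 / p)"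
proof -
  have "\<exists>C. \<forall>f T. (\<Sum>k<T. norm (f k) powr p) \<le> 1 \<longrightarrow> norm (fv f T) \<le> C"
  proof (rule uniform_bound_of_stability[OF p, where K = 1 and r = 1])
    fix T and a b :: "nat \<Rightarrow> 'a"
    show "norm (a T - b T) \<le> 1 * (norm (a T) + norm (b T))"
      by (simp add: norm_triangle_ineq4)
    show "\<exists>B. \<forall>T. norm (fv f T) \<le> B" if "summable (\<lambda>n. norm (f n) powr p)" for f
      using stable[OF that] by (auto simp: bounded_iff)
  qed (auto intro!: continuous_intros)
  then obtain C where C: "\<And>f n. (\<Sum>k<n. norm (f k) powr p) \<le> 1 \<Longrightarrow> norm (fv f n) \<le> C" by blast
  have C0: "C \<ge> 0" using C[where f = "\<lambda>k. 0" and n = 0] by simp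
  have "norm (fv f n) \<le> C * (\<Sum>k<n. norm (f k) powr p) powr (1 / p)" for f n
  proof -
    define S where "S = (\<Sum>k<n. norm (f k) powr p)"
    have S0: "S \<ge> 0" unfolding S_def by (intro sum_nonneg) auto
    show ?thesis
    proof (cases "S = 0")
      case True
      then have "\<forall>k<n. norm (f k) powr p = 0"
        unfolding S_def by (subst (asm) sum_nonneg_eq_0_iff) auto
      then have "fv f n = fv (\<lambda>k. 0) n"
        by (intro forward_values_cong) auto
      then show ?thesis using C0 by (simp add: fv_zero)
    next
      case False
      define s where "s = S powr (1 / p)"
      have s: "s > 0" "s powr p = S" using False S0 p by (auto simp: s_def powr_powr)
      have "(\<Sum>k<n. norm ((1 / s) *\<^sub>R f k) powr p) = S / s powr p"
        using s(1) by (simp add: S_def powr_divide flip: sum_divide_distrib)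
      then have "norm (fv (\<lambda>k. (1 / s) *\<^sub>R f k) n) \<le> C"
        using C[where f = "\<lambda>k. (1 / s) *\<^sub>R f k" and n = n] s False by simp
      then show ?thesis
        using s by (simp add: fv_scaleR field_simps flip: S_def s_def)
    qed
  qed
  with C0 show ?thesis by blast
qed

text \<open>The functional is now a truncated q-th power sum, whence the degree \<open>q\<close> and
  the constant \<open>2 powr q\<close>. Summable inputs suffice because \<open>tail_forcing\<close>
  produces only such forcings.\<close>

lemma power_bound_of_stability:
  assumes q: "q \<ge> 1"
    and stable: "\<And>f. summable (\<lambda>n. norm (f n)) \<Longrightarrow> summable (\<lambda>n. norm (fv f n) powr q)"
  shows "\<exists>C\<ge>0. \<forall>f T. (\<Sum>i\<le>T. norm (fv f i) powr q) \<le> C * (\<Sum>k<T. norm (f k)) powr q"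
proof -
  have "\<exists>C. \<forall>f T. (\<Sum>k<T. norm (f k) powr 1) \<le> 1 \<longrightarrow> (\<Sum>i\<le>T. norm (fv f i) powr q) \<le> C"
  proof (rule uniform_bound_of_stability[where K = "2 powr q" and r = q])
    fix T and a b :: "nat \<Rightarrow> 'a" and c :: real
    have "norm (a i - b i) powr q \<le> 2 powr q * (norm (a i) powr q + norm (b i) powr q)" for i
    proof -
      have "norm (a i - b i) powr q \<le> (norm (a i) + norm (b i)) powr q"
        using q by (intro powr_mono2 norm_triangle_ineq4) auto
      also have "\<dots> \<le> 2 powr q * (norm (a i) powr q + norm (b i) powr q)"
        using q by (intro powr_add_le) auto
      finally show ?thesis .
    qed
    then show "(\<Sum>i\<le>T. norm (a i - b i) powr q)
        \<le> 2 powr q * ((\<Sum>i\<le>T. norm (a i) powr q) + (\<Sum>i\<le>T. norm (b i) powr q))"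
      by (simp add: sum_distrib_left sum_mono flip: sum.distrib)
    show "(\<Sum>i\<le>T. norm (c *\<^sub>R a i) powr q) = c powr q * (\<Sum>i\<le>T. norm (a i) powr q)" if "c > 0"
      using that by (simp add: powr_mult sum_distrib_left)
    show "\<exists>B. \<forall>T. (\<Sum>i\<le>T. norm (fv f i) powr q) \<le> B" if f: "summable (\<lambda>n. norm (f n) powr 1)" for f
    proof -
      have "summable (\<lambda>n. norm (fv f n) powr q)"
        using f by (intro stable) simp
      then have "(\<Sum>i\<le>T. norm (fv f i) powr q) \<le> (\<Sum>i. norm (fv f i) powr q)" for T
        by (intro sum_le_suminf) auto
      then show ?thesis by blast
    qed
  qed (use q in \<open>auto intro!: continuous_intros continuous_on_powr'\<close>)
  then obtain C where C: "\<And>f T. (\<Sum>k<T. norm (f k)) \<le> 1 \<Longrightarrow> (\<Sum>i\<le>T. norm (fv f i) powr q) \<le> C"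
    by auto
  have C0: "C \<ge> 0" using C[where f = "\<lambda>k. 0" and T = 0] by simp
  have "(\<Sum>i\<le>T. norm (fv f i) powr q) \<le> C * (\<Sum>k<T. norm (f k)) powr q" for f T
  proof -
    define s where "s = (\<Sum>k<T. norm (f k))"
    have s0: "s \<ge> 0" unfolding s_def by (intro sum_nonneg) auto
    show ?thesis
    proof (cases "s = 0")
      case True
      then have "\<forall>k<T. norm (f k) = 0"
        unfolding s_def by (subst (asm) sum_nonneg_eq_0_iff) auto
      then have "fv f i = fv (\<lambda>k. 0) i" if "i \<le> T" for i
        using that by (intro forward_values_cong) auto
      then show ?thesis using C0 by (simp add: fv_zero)
    next
      case False
      then have s: "s > 0" using s0 by simp
      have "(\<Sum>k<T. norm ((1 / s) *\<^sub>R f k)) = 1"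
        using s by (simp add: sum_divide_distrib[symmetric] flip: s_def)
      then have "(\<Sum>i\<le>T. norm (fv (\<lambda>k. (1 / s) *\<^sub>R f k) i) powr q) \<le> C"
        using C[where f = "\<lambda>k. (1 / s) *\<^sub>R f k"] by simp
      moreover have "(\<Sum>i\<le>T. norm (fv (\<lambda>k. (1 / s) *\<^sub>R f k) i) powr q)
          = (\<Sum>i\<le>T. norm (fv f i) powr q) / s powr q"
        using s by (subst fv_scaleR) (simp add: powr_divide sum_divide_distrib)
      ultimately show ?thesis
        using s by (simp add: field_simps flip: s_def)
    qed
  qed
  with C0 show ?thesis by blast
qed

section \<open>Uniform bounds on the operators\<close>

lemma fv_impulse_before: "n \<le> k \<Longrightarrow> fv (impulse k v) n = 0"
  using forward_values_cong[of n "impulse k v" "\<lambda>k. 0"] by (simp add: impulse_def fv_zero)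

lemma fv_impulse_at: "fv (impulse k v) (Suc k) = v"
proof -
  have "history (fv (impulse k v)) k = (\<lambda>j. 0)"
    by (auto simp: history_def fv_impulse_before)
  then show ?thesis by (simp add: forward_values_Suc L_zero impulse_def)
qed

lemma norm_impulse_sum: "(\<Sum>i<n. norm (impulse k v i)) \<le> norm v"
proof -
  have "(\<Sum>i<n. norm (impulse k v i)) = (\<Sum>i<n. if i = k then norm v else 0)"
    by (intro sum.cong) (auto simp: impulse_def)
  then show ?thesis by simp
qed

text \<open>Peels off the oldest coordinate. An impulse at time \<open>n - J - 1\<close> produces a
  history that agrees with \<open>\<phi>\<close> at index \<open>J\<close>, vanishes at older
  indices and is bounded at recent ones. Its image under \<open>L n\<close> is the next value of the
  response, hence bounded, and subtracting it leaves support below \<open>J\<close>. The condition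
  \<open>j < n\<close> ensures that there is a time for the impulse.\<close>

lemma L_bound_near:
  assumes C: "\<And>f n. norm (fv f n) \<le> C * (\<Sum>k<n. norm (f k))" "C \<ge> 0"
  shows "\<exists>B\<ge>0. \<forall>n \<phi> c. (\<forall>j. norm (\<phi> j) \<le> c) \<longrightarrow> (\<forall>j. \<phi> j \<noteq> 0 \<longrightarrow> j < J \<and> j < n) \<longrightarrow>
    norm (L n \<phi>) \<le> B * c"
proof (induction J)
  case 0
  have "norm (L n \<phi>) \<le> 0 * c" if "\<forall>j. \<phi> j \<noteq> 0 \<longrightarrow> j < 0 \<and> j < n" for n \<phi> c
  proof -
    have "\<phi> = (\<lambda>j. 0)" using that by auto
    then show ?thesis by (simp add: L_zero)
  qed
  then show ?case by blast
next
  case (Suc J)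
  then obtain B where B: "B \<ge> 0" "\<And>n \<phi> c. (\<forall>j. norm (\<phi> j) \<le> c) \<Longrightarrow>
      (\<forall>j. \<phi> j \<noteq> 0 \<longrightarrow> j < J \<and> j < n) \<Longrightarrow> norm (L n \<phi>) \<le> B * c" by blast
  have "norm (L n \<phi>) \<le> (B * (1 + C) + C) * c"
    if \<phi>: "\<forall>j. norm (\<phi> j) \<le> c" "\<forall>j. \<phi> j \<noteq> 0 \<longrightarrow> j < Suc J \<and> j < n" for n \<phi> c
  proof -
    have c: "c \<ge> 0" using \<phi>(1) order_trans[OF norm_ge_zero] by blast
    show ?thesis
    proof (cases "\<phi> J = 0")
      case True
      then have "\<forall>j. \<phi> j \<noteq> 0 \<longrightarrow> j < J \<and> j < n" using \<phi>(2) less_Suc_eq by metis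
      then have "norm (L n \<phi>) \<le> B * c" using B(2) \<phi>(1) by blast
      also have "\<dots> \<le> (B * (1 + C) + C) * c"
        using B C c by (intro mult_right_mono) (auto simp: algebra_simps)
      finally show ?thesis .
    next
      case False
      then have Jn: "J < n" using \<phi>(2) by blast
      define k where "k = n - J - 1"
      define u where "u = fv (impulse k (\<phi> J))"
      define \<psi> where "\<psi> = history u n"
      have u_le: "norm (u i) \<le> C * c" for i
      proof -
        have "norm (u i) \<le> C * (\<Sum>l<i. norm (impulse k (\<phi> J) l))"
          unfolding u_def by (rule C)
        also have "\<dots> \<le> C * c"
          using norm_impulse_sum \<phi>(1) order_trans C(2) by (intro mult_left_mono) blast+
        finally show ?thesis .
      qed
      have \<psi>_le: "norm (\<psi> j) \<le> C * c" for j
        using u_le C c by (auto simp: \<psi>_def history_def)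
      have \<psi>_zero: "\<psi> j = 0" if "j > J" for j
        using that by (auto simp: \<psi>_def history_def u_def k_def intro!: fv_impulse_before)
      have "n - J = Suc k" using Jn by (simp add: k_def)
      then have \<psi>_J: "\<psi> J = \<phi> J"
        using Jn by (simp add: \<psi>_def history_def u_def fv_impulse_at)
      have "n \<noteq> k" using Jn by (simp add: k_def)
      then have "u (Suc n) = L n \<psi>"
        by (simp add: u_def \<psi>_def forward_values_Suc impulse_def)
      then have L\<psi>: "norm (L n \<psi>) \<le> C * c" using u_le by metis
      define \<delta> where "\<delta> = (\<lambda>j. \<phi> j - \<psi> j)"
      have \<delta>0: "\<delta> j = 0" if "j \<ge> J" for j
        using that \<psi>_J \<psi>_zero[of j] \<phi>(2) by (cases "j = J") (auto simp: \<delta>_def)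
      have "norm (\<delta> j) \<le> (1 + C) * c" for j
        using norm_triangle_ineq4[of "\<phi> j" "\<psi> j"] \<psi>_le[of j] \<phi>(1)
        by (auto simp: \<delta>_def algebra_simps intro: order_trans add_mono)
      moreover have "j < J \<and> j < n" if "\<delta> j \<noteq> 0" for j
        using \<delta>0[of j] Jn that by (cases "j < J") auto
      ultimately have L\<delta>: "norm (L n \<delta>) \<le> B * ((1 + C) * c)"
        by (intro B(2)) auto
      have "L n (\<lambda>j. \<delta> j + \<psi> j) = L n \<delta> + L n \<psi>"
        by (intro L_add weighted_space_finite_support[of J]) (auto simp: \<delta>0 \<psi>_zero)
      then have "L n \<phi> = L n \<delta> + L n \<psi>"
        by (simp add: \<delta>_def)
      then have "norm (L n \<phi>) \<le> norm (L n \<delta>) + norm (L n \<psi>)"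
        using norm_triangle_ineq by metis
      then show ?thesis using L\<delta> L\<psi> by (simp add: algebra_simps)
    qed
  qed
  then show ?case using B C by (intro exI[of _ "B * (1 + C) + C"]) auto
qed

lemma tail_projection_weighted:
  assumes "\<phi> \<in> weighted_space \<gamma>"
  shows "tail_projection m \<phi> \<in> weighted_space \<gamma>"
    and "weighted_norm \<gamma> (tail_projection m \<phi>) \<le> weighted_norm \<gamma> \<phi>"
proof -
  have le: "norm (tail_projection m \<phi> j) * exp (- \<gamma> * real j) \<le> weighted_norm \<gamma> \<phi>" for j
    using weighted_norm_upper[OF assms, of j] weighted_norm_nonneg[OF assms]
    by (auto simp: tail_projection_def)
  then show "tail_projection m \<phi> \<in> weighted_space \<gamma>"
    unfolding weighted_space_def by (auto intro!: bdd_aboveI)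
  show "weighted_norm \<gamma> (tail_projection m \<phi>) \<le> weighted_norm \<gamma> \<phi>"
    by (rule weighted_norm_le) (rule le)
qed

text \<open>\<open>L_bound\<close> makes the supremum in \<open>operator_norm\<close> one over a set
  bounded above. If the weighted norm is 0, the quotient says nothing, but \<open>LK\<close> shows
  that the left side is 0.\<close>

lemma L_tail_bound:
  assumes \<phi>: "\<phi> \<in> weighted_space \<gamma>"
  shows "norm (L n (tail_projection m \<phi>))
    \<le> operator_norm \<gamma> (\<lambda>\<phi>. L n (tail_projection m \<phi>)) * weighted_norm \<gamma> \<phi>"
proof -
  obtain K where K: "K \<ge> 0" "\<And>\<phi>. \<phi> \<in> weighted_space \<gamma> \<Longrightarrow> norm (L n \<phi>) \<le> K * weighted_norm \<gamma> \<phi>"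
    using L_bound by blast
  have LK: "norm (L n (tail_projection m \<psi>)) \<le> K * weighted_norm \<gamma> \<psi>" if "\<psi> \<in> weighted_space \<gamma>" for \<psi>
    using K(2)[OF tail_projection_weighted(1)[OF that]]
      mult_left_mono[OF tail_projection_weighted(2)[OF that] K(1)] by (rule order_trans)
  have "norm (L n (tail_projection m \<psi>)) / weighted_norm \<gamma> \<psi> \<le> K" if "\<psi> \<in> weighted_space \<gamma>" for \<psi>
    using LK[OF that] weighted_norm_nonneg[OF that] K(1)
    by (cases "weighted_norm \<gamma> \<psi> = 0") (auto simp: field_simps)
  then have "norm (L n (tail_projection m \<phi>)) / weighted_norm \<gamma> \<phi>
      \<le> operator_norm \<gamma> (\<lambda>\<phi>. L n (tail_projection m \<phi>))"
    unfolding operator_norm_def using \<phi> by (intro cSUP_upper bdd_aboveI2) auto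
  then show ?thesis
    using LK[OF \<phi>] weighted_norm_nonneg[OF \<phi>]
    by (cases "weighted_norm \<gamma> \<phi> = 0") (auto simp: field_simps)
qed

text \<open>Splits the vector at index \<open>-m\<close>: the tail hypothesis covers the old part
  and \<open>L_bound_near\<close> the recent part, where the weight is at most
  \<open>exp (\<gamma> * real J)\<close>.\<close>

lemma L_uniform_bound:
  assumes C: "\<And>f n. norm (fv f n) \<le> C * (\<Sum>k<n. norm (f k))" "C \<ge> 0"
    and tail: "bdd_above (range (\<lambda>n. operator_norm \<gamma> (\<lambda>\<phi>. L n (tail_projection m \<phi>))))"
  shows "\<exists>M\<ge>0. \<forall>n \<phi> c. (\<forall>j. norm (\<phi> j) \<le> c * exp (\<gamma> * real j)) \<longrightarrow> (\<forall>j\<ge>n. \<phi> j = 0) \<longrightarrow>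
    norm (L n \<phi>) \<le> M * c"
proof -
  obtain M0 where M0: "\<And>n. operator_norm \<gamma> (\<lambda>\<phi>. L n (tail_projection m \<phi>)) \<le> M0"
    using tail by (auto simp: bdd_above_def)
  define J where "J = nat (- m)"
  obtain B where B: "B \<ge> 0" "\<And>n \<phi> c. (\<forall>j. norm (\<phi> j) \<le> c) \<Longrightarrow>
      (\<forall>j. \<phi> j \<noteq> 0 \<longrightarrow> j < J \<and> j < n) \<Longrightarrow> norm (L n \<phi>) \<le> B * c"
    using L_bound_near[OF C, of J] by blast
  have "norm (L n \<phi>) \<le> (B * exp (\<gamma> * real J) + \<bar>M0\<bar>) * c"
    if \<phi>: "\<forall>j. norm (\<phi> j) \<le> c * exp (\<gamma> * real j)" "\<forall>j\<ge>n. \<phi> j = 0" for n \<phi> c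
  proof -
    have c: "c \<ge> 0" using \<phi>(1)[rule_format, of 0] order_trans[OF norm_ge_zero] by simp
    have \<phi>_mem: "\<phi> \<in> weighted_space \<gamma>"
      using \<phi>(2) by (intro weighted_space_finite_support[of n]) auto
    have wn: "weighted_norm \<gamma> \<phi> \<le> c"
      using \<phi>(1) by (intro weighted_norm_le) (simp add: exp_minus field_simps)
    define head where "head = (\<lambda>j. if j < J then \<phi> j else 0)"
    have "norm (head j) \<le> c * exp (\<gamma> * real J)" for j
    proof (cases "j < J")
      case True
      then have "c * exp (\<gamma> * real j) \<le> c * exp (\<gamma> * real J)"
        using c gamma_pos by (intro mult_left_mono) auto
      then show ?thesis using \<phi>(1)[rule_format, of j] True by (simp add: head_def)
    qed (use c in \<open>simp add: head_def\<close>)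
    then have "norm (L n head) \<le> B * (c * exp (\<gamma> * real J))"
      using \<phi>(2) by (intro B(2)) (auto simp: head_def not_le[symmetric] split: if_splits)
    moreover have "norm (L n (tail_projection m \<phi>)) \<le> \<bar>M0\<bar> * c"
    proof -
      have "norm (L n (tail_projection m \<phi>))
          \<le> operator_norm \<gamma> (\<lambda>\<phi>. L n (tail_projection m \<phi>)) * weighted_norm \<gamma> \<phi>"
        by (rule L_tail_bound[OF \<phi>_mem])
      also have "\<dots> \<le> \<bar>M0\<bar> * weighted_norm \<gamma> \<phi>"
        using M0[of n] weighted_norm_nonneg[OF \<phi>_mem] by (intro mult_right_mono) auto
      also have "\<dots> \<le> \<bar>M0\<bar> * c" using wn by (intro mult_left_mono) auto
      finally show ?thesis .
    qed
    moreover have "L n \<phi> = L n head + L n (tail_projection m \<phi>)"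
    proof -
      have "L n (\<lambda>j. head j + tail_projection m \<phi> j) = L n head + L n (tail_projection m \<phi>)"
        by (intro L_add tail_projection_weighted \<phi>_mem weighted_space_finite_support[of J])
          (auto simp: head_def)
      moreover have "(\<lambda>j. head j + tail_projection m \<phi> j) = \<phi>"
        by (auto simp: fun_eq_iff head_def tail_projection_def J_def zless_nat_eq_int_zless)
      ultimately show ?thesis by simp
    qed
    ultimately show ?thesis
      using norm_triangle_ineq[of "L n head" "L n (tail_projection m \<phi>)"] by (simp add: algebra_simps)
  qed
  then show ?thesis using B(1) by (intro exI[of _ "B * exp (\<gamma> * real J) + \<bar>M0\<bar>"]) auto
qed

end

section \<open>Fading memory and homogeneous solutions\<close>

text \<open>Summing the recursion telescopes. It is applied to powers of fading norms and of
  convolutions.\<close>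

lemma linear_recursion_sum_bound:
  fixes a b :: "nat \<Rightarrow> real"
  assumes "\<And>l. a (Suc l) \<le> \<rho> * a l + b l" "\<And>l. a l \<ge> 0" "\<rho> \<ge> 0"
  shows "(1 - \<rho>) * (\<Sum>l<N. a l) \<le> a 0 + (\<Sum>l<N. b l)"
proof -
  have "(1 - \<rho>) * (\<Sum>l<N. a l) + a N \<le> a 0 + (\<Sum>l<N. b l)"
  proof (induction N)
    case (Suc N)
    then show ?case using assms(1)[of N] by (simp add: algebra_simps)
  qed simp
  then show ?thesis using assms(2)[of N] by linarith
qed

lemma shifted_geometric_sum_le:
  fixes \<rho> :: real
  assumes "0 \<le> \<rho>" "\<rho> < 1"
  shows "(\<Sum>k<n. if k < m then 0 else \<rho> ^ (k - m)) \<le> 1 / (1 - \<rho>)"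
proof -
  have "(\<Sum>k<n. if k < m then 0 else \<rho> ^ (k - m)) = (1 - \<rho> ^ (n - m)) / (1 - \<rho>)"
  proof (induction n)
    case (Suc n)
    show ?case
    proof (cases "n < m")
      case False
      then have "Suc n - m = Suc (n - m)" by simp
      have "(\<Sum>k<Suc n. if k < m then 0 else \<rho> ^ (k - m))
          = (1 - \<rho> ^ (n - m)) / (1 - \<rho>) + \<rho> ^ (n - m)"
        using Suc False by simp
      also have "\<dots> = (1 - \<rho> ^ (Suc n - m)) / (1 - \<rho>)"
        using assms \<open>Suc n - m = Suc (n - m)\<close> by (simp add: field_simps)
      finally show ?thesis .
    qed (use Suc in simp)
  qed simp
  also have "\<dots> \<le> 1 / (1 - \<rho>)"
    using assms by (intro divide_right_mono) auto
  finally show ?thesis .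
qed

text \<open>The weighted norm of \<open>history u n\<close>, that is, the maximum of
  \<open>norm (u i) * exp (- \<gamma> * real (n - i))\<close> over \<open>i \<le> n\<close>, in a
  form suited to one-step estimates.\<close>

primrec fading_norm :: "real \<Rightarrow> (nat \<Rightarrow> 'a::real_normed_vector) \<Rightarrow> nat \<Rightarrow> real" where
  "fading_norm \<gamma> u 0 = norm (u 0)"
| "fading_norm \<gamma> u (Suc n) = max (norm (u (Suc n))) (exp (- \<gamma>) * fading_norm \<gamma> u n)"

lemma fading_norm_ge_norm: "norm (u n) \<le> fading_norm \<gamma> u n"
  by (cases n) auto

lemma fading_norm_nonneg: "0 \<le> fading_norm \<gamma> u n"
  using fading_norm_ge_norm order_trans norm_ge_zero by blast

lemma fading_norm_upper: "i \<le> n \<Longrightarrow> norm (u i) \<le> fading_norm \<gamma> u n * exp (\<gamma> * real (n - i))"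
proof (induction n)
  case (Suc n)
  show ?case
  proof (cases "i = Suc n")
    case False
    then have i: "i \<le> n" "Suc n - i = Suc (n - i)" using Suc.prems by auto
    have "exp (- \<gamma>) * fading_norm \<gamma> u n * exp (\<gamma> * real (Suc (n - i)))
        \<le> fading_norm \<gamma> u (Suc n) * exp (\<gamma> * real (Suc (n - i)))"
      by (intro mult_right_mono) auto
    moreover have "exp (- \<gamma>) * fading_norm \<gamma> u n * exp (\<gamma> * real (Suc (n - i)))
        = fading_norm \<gamma> u n * exp (\<gamma> * real (n - i))"
      by (simp add: distrib_left exp_add exp_minus)
    ultimately show ?thesis
      using Suc.IH i by (metis order_trans)
  qed auto
qed simp

text \<open>The last \<open>l\<close> entries are bounded by \<open>b\<close>; everything older has
  aged by \<open>l\<close> steps.\<close>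

lemma fading_norm_le:
  assumes "\<gamma> \<ge> 0" "\<And>k. n < k \<Longrightarrow> k \<le> n + l \<Longrightarrow> norm (u k) \<le> b"
  shows "fading_norm \<gamma> u (n + l) \<le> max b (exp (- \<gamma> * real l) * fading_norm \<gamma> u n)"
  using assms(2)
proof (induction l)
  case (Suc l)
  show ?case
  proof -
    have u: "norm (u (Suc (n + l))) \<le> b" using Suc.prems by simp
    then have b: "b \<ge> 0" using order_trans[OF norm_ge_zero] by blast
    have "fading_norm \<gamma> u (n + l) \<le> max b (exp (- \<gamma> * real l) * fading_norm \<gamma> u n)"
      using Suc by simp
    then have "exp (- \<gamma>) * fading_norm \<gamma> u (n + l)
        \<le> max (exp (- \<gamma>) * b) (exp (- \<gamma>) * (exp (- \<gamma> * real l) * fading_norm \<gamma> u n))"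
      by (simp add: max_def split: if_splits)
    also have "\<dots> \<le> max b (exp (- \<gamma> * real (Suc l)) * fading_norm \<gamma> u n)"
    proof (rule max.mono)
      show "exp (- \<gamma>) * b \<le> b" using b assms(1) by (simp add: mult_left_le_one_le)
      show "exp (- \<gamma>) * (exp (- \<gamma> * real l) * fading_norm \<gamma> u n)
          \<le> exp (- \<gamma> * real (Suc l)) * fading_norm \<gamma> u n"
        by (simp add: distrib_left exp_add[symmetric] mult.assoc[symmetric])
    qed
    finally show ?thesis using u by simp
  qed
qed simp

locale uniform_delay_system = delay_system +
  fixes C M :: real
  assumes fv_le: "norm (fv f n) \<le> C * (\<Sum>k<n. norm (f k))"
    and L_le: "\<lbrakk>\<And>j. norm (\<phi> j) \<le> c * exp (\<gamma> * real j); \<And>j. j \<ge> n \<Longrightarrow> \<phi> j = 0\<rbrakk> \<Longrightarrow> norm (L n \<phi>) \<le> M * c"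
    and C_nonneg: "C \<ge> 0" and M_nonneg: "M \<ge> 0"
begin

abbreviation "fading \<equiv> fading_norm \<gamma>"

text \<open>The values up to time \<open>m\<close> are an arbitrary initial history except for
  \<open>u 0 = 0\<close>, which makes \<open>history u n\<close> vanish at indices
  \<open>j \<ge> n\<close>, as \<open>L_le\<close> demands.\<close>

definition homogeneous_from :: "nat \<Rightarrow> (nat \<Rightarrow> 'a) \<Rightarrow> bool" where
  "homogeneous_from m u \<longleftrightarrow> u 0 = 0 \<and> (\<forall>n\<ge>m. u (Suc n) = L n (history u n))"

lemma homogeneous_from_mono: "homogeneous_from m u \<Longrightarrow> m \<le> n \<Longrightarrow> homogeneous_from n u"
  by (simp add: homogeneous_from_def)

text \<open>\<open>M\<close> times the geometric series in \<open>exp (- \<gamma>)\<close>: a bound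
  for the total forcing exerted by a history of fading norm 1.\<close>

definition E where "E = M / (1 - exp (- \<gamma>))"

lemma E_nonneg: "E \<ge> 0"
  using M_nonneg gamma_pos by (simp add: E_def)

text \<open>The forcing \<open>f\<close> is what the discarded history contributes; it decays exponentially because
  that history recedes.\<close>

lemma tail_forcing:
  assumes u: "homogeneous_from m u"
  shows "\<exists>f. (\<forall>n. fv f n = (if n > m then u n else 0)) \<and> (\<forall>n. (\<Sum>k<n. norm (f k)) \<le> E * fading u m)"
proof -
  define y where "y = (\<lambda>n. if n > m then u n else 0)"
  define f where "f = (\<lambda>k. y (Suc k) - L k (history y k))"
  have "fv f n = y n" for n
    by (rule forward_values_residual) (auto simp: y_def f_def)
  moreover have f_le: "norm (f k) \<le> M * fading u m * (if k < m then 0 else exp (- \<gamma>) ^ (k - m))" for k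
  proof (cases "k < m")
    case True
    then have "history y k = (\<lambda>j. 0)" by (auto simp: fun_eq_iff history_def y_def)
    then show ?thesis using True by (simp add: f_def y_def L_zero)
  next
    case False
    define \<phi> where "\<phi> = (\<lambda>j. history u k j - history y k j)"
    have "f k = L k \<phi>"
      using u False unfolding \<phi>_def
      by (subst L_diff) (auto simp: history_weighted f_def y_def homogeneous_from_def)
    moreover have "norm (L k \<phi>) \<le> M * (fading u m * exp (- \<gamma> * real (k - m)))"
    proof (rule L_le)
      show "norm (\<phi> j) \<le> fading u m * exp (- \<gamma> * real (k - m)) * exp (\<gamma> * real j)" for j
      proof (cases "j \<le> k \<and> k - j \<le> m")
        case True
        \<comment> \<open>At time \<open>k\<close> the entry \<open>u (k - j)\<close> is
          \<open>k - m\<close> steps older than at time \<open>m\<close>; this gap is the decay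
          factor.\<close>
        have "m - (k - j) + (k - m) = j"
          using True False by auto
        then have *: "real (m - (k - j)) = real j - real (k - m)"
          by linarith
        have "exp (\<gamma> * (x - r)) = exp (- \<gamma> * r) * exp (\<gamma> * x)" for x r
          by (simp add: exp_add[symmetric] algebra_simps)
        then have "exp (\<gamma> * real (m - (k - j))) = exp (- \<gamma> * real (k - m)) * exp (\<gamma> * real j)"
          unfolding * .
        then show ?thesis
          using fading_norm_upper[of "k - j" m u \<gamma>] True
          by (simp add: \<phi>_def history_def y_def mult.assoc)
      next
        case False
        then have "\<phi> j = 0" by (auto simp: \<phi>_def history_def y_def)
        then show ?thesis by (simp add: fading_norm_nonneg)
      qed
      show "\<phi> j = 0" if "j \<ge> k" for j
        using that u by (auto simp: \<phi>_def history_def y_def homogeneous_from_def)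
    qed
    ultimately show ?thesis using False by (simp add: exp_of_nat_mult[symmetric] ac_simps)
  qed
  moreover have "(\<Sum>k<n. norm (f k)) \<le> E * fading u m" for n
  proof -
    have "(\<Sum>k<n. norm (f k)) \<le> (\<Sum>k<n. M * fading u m * (if k < m then 0 else exp (- \<gamma>) ^ (k - m)))"
      by (intro sum_mono f_le)
    also have "\<dots> = M * fading u m * (\<Sum>k<n. if k < m then 0 else exp (- \<gamma>) ^ (k - m))"
      by (simp add: sum_distrib_left)
    also have "\<dots> \<le> M * fading u m * (1 / (1 - exp (- \<gamma>)))"
      using M_nonneg gamma_pos
      by (intro mult_left_mono shifted_geometric_sum_le mult_nonneg_nonneg fading_norm_nonneg) auto
    finally show ?thesis by (simp add: E_def)
  qed
  ultimately show ?thesis by (intro exI[of _ f]) (auto simp: y_def)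
qed

text \<open>The 1 serves the starting time, where the truncated solution is zero and gives no bound;
  \<open>C * E\<close> serves all later times.\<close>

definition G where "G = max 1 (C * E)"

lemma G_ge_1: "G \<ge> 1"
  by (simp add: G_def)

lemma homogeneous_norm_le:
  assumes u: "homogeneous_from m u" and n: "n \<ge> m"
  shows "norm (u n) \<le> G * fading u m"
proof (cases "n = m")
  case True
  have "fading u m \<le> G * fading u m"
    using mult_right_mono[OF G_ge_1 fading_norm_nonneg[of \<gamma> u m]] by simp
  then show ?thesis using fading_norm_ge_norm[of u m \<gamma>] True by simp
next
  case False
  obtain f where f: "\<And>n. fv f n = (if n > m then u n else 0)"
      "\<And>n. (\<Sum>k<n. norm (f k)) \<le> E * fading u m"
    using tail_forcing[OF u] by blast
  have "norm (u n) = norm (fv f n)" using False n by (simp add: f)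
  also have "\<dots> \<le> C * (E * fading u m)"
    using fv_le[of f n] mult_left_mono[OF f(2)[of n] C_nonneg] by (rule order_trans)
  also have "\<dots> \<le> G * fading u m"
    unfolding mult.assoc[symmetric] by (intro mult_right_mono fading_norm_nonneg) (simp add: G_def)
  finally show ?thesis .
qed

lemma homogeneous_fading_le:
  assumes u: "homogeneous_from m u"
  shows "fading u (m + l) \<le> G * fading u m"
proof -
  have "fading u (m + l) \<le> max (G * fading u m) (exp (- \<gamma> * real l) * fading u m)"
    using homogeneous_norm_le[OF u] gamma_pos by (intro fading_norm_le) auto
  moreover have "exp (- \<gamma> * real l) * fading u m \<le> G * fading u m"
    using G_ge_1 gamma_pos by (intro mult_right_mono fading_norm_nonneg) (auto intro: order_trans[of _ 1])
  ultimately show ?thesis by auto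
qed

section \<open>Two routes to uniform decay\<close>

text \<open>The rate is the same for all \<open>m\<close> and \<open>u\<close>. The index 0 is left
  out because the rates constructed below take the value 0 there, by division by zero or as a power
  of 0.\<close>

definition decaying :: "(nat \<Rightarrow> real) \<Rightarrow> bool" where
  "decaying \<kappa> \<longleftrightarrow> \<kappa> \<longlonglongrightarrow> 0 \<and>
    (\<forall>m u i. homogeneous_from m u \<longrightarrow> i \<ge> 1 \<longrightarrow> norm (u (m + i)) \<le> \<kappa> i * fading u m)"

text \<open>Datko's argument: a q-th power sum bounded independently of its length, together with
  the growth bound \<open>G\<close>, forces its last term to be small.\<close>

lemma decaying_of_power_bound:
  assumes q: "q \<ge> 1" and B: "B \<ge> 0"
    "\<And>f T. (\<Sum>i\<le>T. norm (fv f i) powr q) \<le> B * (\<Sum>k<T. norm (f k)) powr q"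
  shows "\<exists>\<kappa>. decaying \<kappa>"
proof -
  define \<rho> where "\<rho> = exp (- \<gamma>) powr q"
  have \<rho>: "0 \<le> \<rho>" "\<rho> < 1"
    using gamma_pos q by (auto simp: \<rho>_def powr_def)
  define H where "H = G powr q * ((1 + B * E powr q) / (1 - \<rho>))"
  have H0: "H \<ge> 0" unfolding H_def using \<rho> B by (intro mult_nonneg_nonneg divide_nonneg_nonneg) auto
  have "norm (u (m + i)) \<le> (H / real i) powr (1 / q) * fading u m"
    if u: "homogeneous_from m u" and i: "i \<ge> 1" for m u i
  proof -
    define s where "s = fading u m"
    have s0: "s \<ge> 0" by (simp add: s_def fading_norm_nonneg)
    obtain f where f: "\<And>n. fv f n = (if n > m then u n else 0)"
        "\<And>n. (\<Sum>k<n. norm (f k)) \<le> E * s"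
      using tail_forcing[OF u] by (auto simp: s_def)
    have "(\<Sum>l<i. norm (u (Suc (m + l))) powr q) = (\<Sum>l\<in>(\<lambda>l. Suc (m + l)) ` {..<i}. norm (fv f l) powr q)"
      by (subst sum.reindex) (auto simp: inj_on_def f)
    also have "\<dots> \<le> (\<Sum>l\<le>m + i. norm (fv f l) powr q)"
      by (intro sum_mono2) auto
    also have "\<dots> \<le> B * (\<Sum>k<m + i. norm (f k)) powr q" by (rule B)
    also have "\<dots> \<le> B * (E * s) powr q"
      using B q f(2) by (intro mult_left_mono powr_mono2) (auto intro: sum_nonneg)
    finally have u_sum: "(\<Sum>l<i. norm (u (Suc (m + l))) powr q) \<le> B * (E * s) powr q" .
    \<comment> \<open>The maximum in the recursion is at most the sum, so summability passes from
      \<open>u\<close> to its fading norms.\<close>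
    have "fading u (m + Suc l) powr q \<le> \<rho> * fading u (m + l) powr q + norm (u (Suc (m + l))) powr q" for l
      using fading_norm_nonneg[of \<gamma> u "m + l"] by (auto simp: max_def \<rho>_def powr_mult)
    then have "(1 - \<rho>) * (\<Sum>l<i. fading u (m + l) powr q)
        \<le> s powr q + (\<Sum>l<i. norm (u (Suc (m + l))) powr q)"
      using linear_recursion_sum_bound[where a = "\<lambda>l. fading u (m + l) powr q" and \<rho> = \<rho> and N = i] \<rho>
      by (simp add: s_def)
    also have "\<dots> \<le> (1 + B * E powr q) * s powr q"
      using u_sum E_nonneg s0 by (simp add: powr_mult algebra_simps)
    finally have fsum: "(\<Sum>l<i. fading u (m + l) powr q) \<le> (1 + B * E powr q) / (1 - \<rho>) * s powr q"
      using \<rho> by (simp add: field_simps)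
    \<comment> \<open>Each of the \<open>i\<close> states at times \<open>m + l\<close>,
      \<open>l < i\<close>, can serve as initial state for \<open>u (m + i)\<close>; adding up the
      resulting bounds gains the factor \<open>1 / real i\<close>.\<close>
    have "real i * norm (u (m + i)) powr q = (\<Sum>l<i. norm (u (m + i)) powr q)" by simp
    also have "\<dots> \<le> (\<Sum>l<i. (G * fading u (m + l)) powr q)"
    proof (rule sum_mono)
      fix l assume "l \<in> {..<i}"
      then have "norm (u (m + i)) \<le> G * fading u (m + l)"
        using homogeneous_norm_le[OF homogeneous_from_mono[OF u, of "m + l"], of "m + i"] by simp
      then show "norm (u (m + i)) powr q \<le> (G * fading u (m + l)) powr q"
        using q by (intro powr_mono2) auto
    qed
    also have "\<dots> = G powr q * (\<Sum>l<i. fading u (m + l) powr q)"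
      using G_ge_1 by (simp add: powr_mult fading_norm_nonneg sum_distrib_left)
    also have "\<dots> \<le> G powr q * ((1 + B * E powr q) / (1 - \<rho>) * s powr q)"
      by (intro mult_left_mono fsum) auto
    also have "\<dots> = H * s powr q" by (simp add: H_def)
    finally have "norm (u (m + i)) powr q \<le> H / real i * s powr q"
      using i by (simp add: field_simps)
    then have "(norm (u (m + i)) powr q) powr (1 / q) \<le> (H / real i * s powr q) powr (1 / q)"
      using q by (intro powr_mono2) auto
    also have "\<dots> = (H / real i) powr (1 / q) * s"
      using q s0 by (simp only: powr_mult powr_powr) simp
    finally show ?thesis
      using q by (simp add: powr_powr s_def)
  qed
  moreover have "(\<lambda>i. (H / real i) powr (1 / q)) \<longlonglongrightarrow> 0"
  proof -
    have "(\<lambda>i. H / real i) \<longlonglongrightarrow> 0"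
      by (rule tendsto_divide_0[OF tendsto_const filterlim_at_top_imp_at_infinity[OF filterlim_real_sequentially]])
    moreover have "\<forall>\<^sub>F i in sequentially. 0 \<le> H / real i" using H0 by simp
    ultimately show ?thesis
      using tendsto_powr'[of "\<lambda>i. H / real i" 0 sequentially "\<lambda>_. 1 / q" "1 / q"] q by simp
  qed
  ultimately show ?thesis unfolding decaying_def by blast
qed

text \<open>
  Multiplying by the ramp \<open>A\<close>, which climbs from \<open>0\<close> to \<open>1\<close> within \<open>N\<close> steps, costs a forcing
  of size \<open>O(1 / N)\<close> on a window of length \<open>N\<close>, whose \<open>\<ell>\<^sup>p\<close> norm vanishes as \<open>N\<close> grows
  because \<open>p > 1\<close>.
\<close>

lemma decaying_of_sup_bound:
  assumes p: "p > 1" and B: "B \<ge> 0"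
    "\<And>f n. norm (fv f n) \<le> B * (\<Sum>k<n. norm (f k) powr p) powr (1 / p)"
  shows "\<exists>\<kappa>. decaying \<kappa>"
proof -
  \<comment> \<open>Chosen to trade the linear growth of ramp differences for the exponential
    weight.\<close>
  define c where "c = 1 + 1 / \<gamma>"
  have c0: "c \<ge> 0" using gamma_pos by (simp add: c_def)
  have c: "real (Suc i) \<le> c * exp (\<gamma> * real i)" for i
  proof -
    have "real (Suc i) \<le> c * (1 + \<gamma> * real i)"
      using gamma_pos by (simp add: c_def field_simps)
    also have "\<dots> \<le> c * exp (\<gamma> * real i)"
      using c0 exp_ge_add_one_self by (intro mult_left_mono) auto
    finally show ?thesis .
  qed
  define H where "H = M * c * G"
  have H0: "H \<ge> 0" using M_nonneg c0 G_ge_1 by (simp add: H_def)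
  have "norm (u (m + N)) \<le> B * H * real N powr (1 / p - 1) * fading u m"
    if u: "homogeneous_from m u" and N: "N \<ge> 1" for m u N
  proof -
    define s where "s = fading u m"
    have s0: "s \<ge> 0" by (simp add: s_def fading_norm_nonneg)
    \<comment> \<open>Truncated subtraction makes \<open>A\<close> vanish up to time
      \<open>m\<close>; it is 1 from \<open>m + N\<close> on.\<close>
    define A where "A = (\<lambda>l. min 1 (real (l - m) / real N))"
    define y where "y = (\<lambda>l. A l *\<^sub>R u l)"
    define f where "f = (\<lambda>k. y (Suc k) - L k (history y k))"
    have "fv f (m + N) = y (m + N)"
      using u by (intro forward_values_residual) (auto simp: y_def f_def homogeneous_from_def)
    then have fv_f: "fv f (m + N) = u (m + N)"
      using N by (simp add: y_def A_def)
    have f0: "f k = 0" if "k < m" for k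
    proof -
      have "history y k = (\<lambda>j. 0)" using that by (auto simp: fun_eq_iff history_def y_def A_def)
      then show ?thesis using that by (simp add: f_def y_def A_def L_zero)
    qed
    have f_le: "norm (f k) \<le> H * s / real N" if k: "k \<ge> m" for k
    proof -
      \<comment> \<open>By linearity of \<open>L k\<close> the ramp factor \<open>A (Suc k)\<close>
        moves inside, so the defect involves only differences of ramp values.\<close>
      define \<phi> where "\<phi> = (\<lambda>j. A (Suc k) *\<^sub>R history u k j - history y k j)"
      have "(\<lambda>j. A (Suc k) *\<^sub>R history u k j) \<in> weighted_space \<gamma>"
        by (rule weighted_space_finite_support[of k]) (simp add: history_def)
      then have "f k = L k \<phi>"
        using u k unfolding \<phi>_def
        by (subst L_diff) (auto simp: L_scaleR history_weighted f_def y_def homogeneous_from_def)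
      moreover have "norm (L k \<phi>) \<le> M * (c * G * s / real N)"
      proof (rule L_le)
        show "\<phi> j = 0" if "j \<ge> k" for j
          using that u by (auto simp: \<phi>_def history_def y_def homogeneous_from_def)
        show "norm (\<phi> j) \<le> c * G * s / real N * exp (\<gamma> * real j)" for j
        proof (cases "j \<le> k")
          case False
          then show ?thesis using c0 G_ge_1 s0 by (simp add: \<phi>_def history_def)
        next
          case jk: True
          have \<phi>: "\<phi> j = (A (Suc k) - A (k - j)) *\<^sub>R u (k - j)"
            using jk by (simp add: \<phi>_def history_def y_def scaleR_diff_left)
          show ?thesis
          proof (cases "k - j \<le> m")
            case True
            \<comment> \<open>For an entry not later than \<open>m\<close>, the exponents
              \<open>k - m\<close> from the ramp and \<open>m - (k - j)\<close> from the memory add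
              up to \<open>j\<close>.\<close>
            have "A (k - j) = 0" using True by (simp add: A_def)
            moreover have "0 \<le> A (Suc k)" "A (Suc k) \<le> real (Suc (k - m)) / real N"
              using k by (simp_all add: A_def Suc_diff_le)
            ultimately have "\<bar>A (Suc k) - A (k - j)\<bar> \<le> c * exp (\<gamma> * real (k - m)) / real N"
              using c[of "k - m"] N by (auto intro: order_trans simp: divide_right_mono)
            moreover have "norm (u (k - j)) \<le> s * exp (\<gamma> * real (m - (k - j)))"
              unfolding s_def using True by (rule fading_norm_upper)
            ultimately have "norm (\<phi> j)
                \<le> (c * exp (\<gamma> * real (k - m)) / real N) * (s * exp (\<gamma> * real (m - (k - j))))"
              unfolding \<phi> norm_scaleR using c0 by (intro mult_mono) auto
            also have "\<dots> = c * 1 * s / real N * (exp (\<gamma> * real (k - m)) * exp (\<gamma> * real (m - (k - j))))"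
              by simp
            also have "exp (\<gamma> * real (k - m)) * exp (\<gamma> * real (m - (k - j))) = exp (\<gamma> * real j)"
              using True jk k by (simp add: exp_add[symmetric] of_nat_diff algebra_simps)
            also have "c * 1 * s / real N * exp (\<gamma> * real j) \<le> c * G * s / real N * exp (\<gamma> * real j)"
              using c0 s0 G_ge_1 by (intro mult_right_mono divide_right_mono mult_left_mono) auto
            finally show ?thesis .
          next
            case False
            \<comment> \<open>For an entry after \<open>m\<close>, the ramp changes by at most
              \<open>1 / N\<close> per step over \<open>j + 1\<close> steps, and \<open>u\<close> is
              bounded by \<open>G * s\<close>.\<close>
            have "\<bar>A (Suc k) - A (k - j)\<bar> \<le> real (Suc j) / real N"
            proof -
              have *: "real (Suc k - m) / real N = real (k - j - m) / real N + real (Suc j) / real N"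
                using False k jk by (simp add: add_divide_distrib[symmetric] of_nat_diff)
              have min_diff: "\<bar>min 1 (b + d) - min 1 b\<bar> \<le> d" if "d \<ge> 0" for b d :: real
                using that by (simp add: min_def abs_if)
              show ?thesis unfolding A_def * by (rule min_diff) simp
            qed
            also have "\<dots> \<le> c * exp (\<gamma> * real j) / real N"
              using c by (intro divide_right_mono) auto
            finally have "norm (\<phi> j) \<le> (c * exp (\<gamma> * real j) / real N) * (G * s)"
              unfolding \<phi> norm_scaleR using c0 homogeneous_norm_le[OF u, of "k - j"] False
              by (intro mult_mono) (auto simp: s_def)
            then show ?thesis by (simp add: ac_simps)
          qed
        qed
      qed
      ultimately show ?thesis by (simp add: H_def ac_simps)
    qed
    have "(\<Sum>k<m + N. norm (f k) powr p) = (\<Sum>k\<in>{m..<m + N}. norm (f k) powr p)"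
      using f0 by (intro sum.mono_neutral_right) auto
    also have "\<dots> \<le> (\<Sum>k\<in>{m..<m + N}. (H * s / real N) powr p)"
      using f_le p by (intro sum_mono powr_mono2) auto
    also have "\<dots> = real N * (H * s / real N) powr p" by simp
    finally have "(\<Sum>k<m + N. norm (f k) powr p) powr (1 / p)
        \<le> (real N * (H * s / real N) powr p) powr (1 / p)"
      using p by (intro powr_mono2 sum_nonneg) auto
    also have "\<dots> = real N powr (1 / p) * (H * s / real N)"
      using p H0 s0 by (simp add: powr_mult powr_powr)
    also have "\<dots> = H * real N powr (1 / p - 1) * s"
      using N by (simp add: powr_diff)
    finally have f_norm: "(\<Sum>k<m + N. norm (f k) powr p) powr (1 / p) \<le> H * real N powr (1 / p - 1) * s" .
    have "norm (u (m + N)) \<le> B * (\<Sum>k<m + N. norm (f k) powr p) powr (1 / p)"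
      using B(2)[of f "m + N"] by (simp only: fv_f)
    also have "\<dots> \<le> B * (H * real N powr (1 / p - 1) * s)"
      using B(1) f_norm by (intro mult_left_mono)
    finally show ?thesis by (simp add: s_def ac_simps)
  qed
  moreover have "(\<lambda>N. B * H * real N powr (1 / p - 1)) \<longlonglongrightarrow> 0"
    using p by (intro tendsto_mult_right_zero tendsto_neg_powr filterlim_real_sequentially) auto
  ultimately show ?thesis unfolding decaying_def by blast
qed

end

section \<open>Geometric convolution of sequences\<close>

text \<open>If \<open>a \<le> \<delta> * b\<close>, the gap between \<open>\<rho>\<close> and
  \<open>(1 + \<rho>) / 2\<close> absorbs \<open>a\<close>, and taking the p-th power only shrinks a
  factor below 1. Otherwise \<open>b\<close> is at most \<open>a / \<delta>\<close>, and a multiple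
  of \<open>a\<close> bounds everything.\<close>

lemma powr_affine_le:
  fixes \<rho> p :: real
  assumes \<rho>: "0 \<le> \<rho>" "\<rho> < 1" and p: "p \<ge> 1"
  shows "\<exists>c\<ge>0. \<forall>a\<ge>0. \<forall>b\<ge>0. (\<rho> * b + a) powr p \<le> (1 + \<rho>) / 2 * b powr p + c * a powr p"
proof -
  define \<delta> where "\<delta> = (1 - \<rho>) / 2"
  have \<delta>: "\<delta> > 0" "\<rho> + \<delta> = (1 + \<rho>) / 2" using \<rho> by (auto simp: \<delta>_def field_simps)
  have "(\<rho> * b + a) powr p \<le> (1 + \<rho>) / 2 * b powr p + (\<rho> / \<delta> + 1) powr p * a powr p"
    if ab: "a \<ge> 0" "b \<ge> 0" for a b
  proof (cases "a \<le> \<delta> * b")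
    case True
    have "(\<rho> * b + a) powr p \<le> ((1 + \<rho>) / 2 * b) powr p"
      using True ab \<rho> p unfolding \<delta>(2)[symmetric] by (intro powr_mono2) (auto simp: algebra_simps)
    also have "\<dots> = ((1 + \<rho>) / 2) powr p * b powr p"
      using ab \<rho> by (simp only: powr_mult)
    also have "\<dots> \<le> (1 + \<rho>) / 2 * b powr p"
      using \<rho> p powr_mono'[of 1 p "(1 + \<rho>) / 2"] by (intro mult_right_mono) auto
    finally show ?thesis by (simp add: add_increasing2)
  next
    case False
    then have "b \<le> a / \<delta>" using \<delta>(1) by (simp add: field_simps)
    then have "\<rho> * b + a \<le> (\<rho> / \<delta> + 1) * a"
      using mult_left_mono[OF _ \<rho>(1)] by (fastforce simp: algebra_simps)
    then have "(\<rho> * b + a) powr p \<le> ((\<rho> / \<delta> + 1) * a) powr p"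
      using ab \<rho> p by (intro powr_mono2) auto
    also have "\<dots> = (\<rho> / \<delta> + 1) powr p * a powr p"
      using ab \<rho> \<delta> by (simp only: powr_mult)
    finally show ?thesis using ab \<rho> by (simp add: add_increasing)
  qed
  then show ?thesis by (intro exI[of _ "(\<rho> / \<delta> + 1) powr p"]) auto
qed

lemma geometric_convolution_Suc:
  fixes \<rho> :: real
  shows "(\<Sum>k<Suc n. \<rho> ^ (n - k) * a k) = \<rho> * (\<Sum>k<n. \<rho> ^ (n - 1 - k) * a k) + a n"
proof -
  have "(\<Sum>k<n. \<rho> ^ (n - k) * a k) = (\<Sum>k<n. \<rho> * (\<rho> ^ (n - 1 - k) * a k))"
  proof (rule sum.cong)
    fix k assume "k \<in> {..<n}"
    then have "n - k = Suc (n - 1 - k)" by auto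
    then show "\<rho> ^ (n - k) * a k = \<rho> * (\<rho> ^ (n - 1 - k) * a k)" by simp
  qed simp
  then show ?thesis by (simp add: sum_distrib_left)
qed

text \<open>The recursion \<open>b (Suc n) = \<rho> * b n + a n\<close> passes to the \<open>p\<close>-th powers with a larger
  \<open>\<rho> < 1\<close>.\<close>

lemma summable_geometric_convolution:
  fixes a :: "nat \<Rightarrow> real"
  assumes \<rho>: "0 \<le> \<rho>" "\<rho> < 1" and p: "p \<ge> 1" and a: "\<And>n. a n \<ge> 0"
    and sm: "summable (\<lambda>n. a n powr p)"
  shows "summable (\<lambda>n. (\<Sum>k<n. \<rho> ^ (n - 1 - k) * a k) powr p)"
proof -
  define b where "b = (\<lambda>n. \<Sum>k<n. \<rho> ^ (n - 1 - k) * a k)"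
  have b0: "b n \<ge> 0" for n
    unfolding b_def using \<rho> a by (intro sum_nonneg) auto
  have b_Suc: "b (Suc n) = \<rho> * b n + a n" for n
    unfolding b_def using geometric_convolution_Suc[of \<rho> n a] by simp
  obtain c where c: "c \<ge> 0"
      "\<And>a b. a \<ge> 0 \<Longrightarrow> b \<ge> 0 \<Longrightarrow> (\<rho> * b + a) powr p \<le> (1 + \<rho>) / 2 * b powr p + c * a powr p"
    using powr_affine_le[OF \<rho> p] by blast
  have "(\<Sum>n<N. b n powr p) \<le> c * (\<Sum>n. a n powr p) / (1 - (1 + \<rho>) / 2)" for N
  proof -
    have "(1 - (1 + \<rho>) / 2) * (\<Sum>n<N. b n powr p) \<le> b 0 powr p + (\<Sum>n<N. c * a n powr p)"
      using \<rho> c(2)[OF a b0] by (intro linear_recursion_sum_bound) (auto simp: b_Suc)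
    also have "\<dots> = c * (\<Sum>n<N. a n powr p)"
      by (simp add: b_def sum_distrib_left)
    also have "\<dots> \<le> c * (\<Sum>n. a n powr p)"
      using c(1) sm by (intro mult_left_mono sum_le_suminf) auto
    finally show ?thesis
      using \<rho> by (simp add: field_simps)
  qed
  then have "summable (\<lambda>n. b n powr p)"
    by (intro bounded_imp_summable[where B = "c * (\<Sum>n. a n powr p) / (1 - (1 + \<rho>) / 2)"])
      (auto simp: lessThan_Suc_atMost[symmetric] simp del: sum.lessThan_Suc)
  then show ?thesis by (simp only: b_def)
qed

lemma bounded_geometric_convolution:
  fixes a :: "nat \<Rightarrow> real"
  assumes \<rho>: "0 \<le> \<rho>" "\<rho> < 1" and a: "\<And>n. a n \<le> B" and B: "B \<ge> 0"
  shows "(\<Sum>k<n. \<rho> ^ (n - 1 - k) * a k) \<le> B / (1 - \<rho>)"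
proof (induction n)
  case (Suc n)
  have "(\<Sum>k<Suc n. \<rho> ^ (n - k) * a k) \<le> \<rho> * (B / (1 - \<rho>)) + B"
    unfolding geometric_convolution_Suc using Suc a \<rho> by (intro add_mono mult_left_mono) auto
  also have "\<dots> = B / (1 - \<rho>)" using \<rho> by (simp add: field_simps)
  finally show ?case by simp
qed (use \<rho> B in simp)

section \<open>From uniform decay to exponential decay\<close>

context uniform_delay_system
begin

text \<open>Two phases of equal length \<open>j\<close>. After the first, \<open>\<kappa>\<close>
  keeps all entries below half the initial fading norm. During the second, whatever is stored at
  time \<open>m + j\<close> ages by \<open>j\<close> steps, which outweighs the growth factor
  \<open>G\<close>.\<close>

lemma fading_contraction:
  assumes "decaying \<kappa>"
  shows "\<exists>P\<ge>1. \<forall>m u. homogeneous_from m u \<longrightarrow> fading u (m + P) \<le> fading u m / 2"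
proof -
  have \<kappa>: "\<kappa> \<longlonglongrightarrow> 0"
    "\<And>m u i. homogeneous_from m u \<Longrightarrow> i \<ge> 1 \<Longrightarrow> norm (u (m + i)) \<le> \<kappa> i * fading u m"
    using assms by (auto simp: decaying_def)
  have "(\<lambda>i. exp (- \<gamma>) ^ i) \<longlonglongrightarrow> 0"
    using gamma_pos by (intro LIMSEQ_realpow_zero) auto
  then have "(\<lambda>i. exp (- \<gamma> * real i)) \<longlonglongrightarrow> 0"
    by (simp add: exp_of_nat_mult[symmetric] mult.commute)
  then have "(\<lambda>i. exp (- \<gamma> * real i) * G) \<longlonglongrightarrow> 0"
    by (rule tendsto_mult_left_zero)
  then have "\<forall>\<^sub>F i in sequentially. exp (- \<gamma> * real i) * G < 1 / 2"
    by (rule order_tendstoD) simp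
  moreover have "\<forall>\<^sub>F i in sequentially. \<kappa> i < 1 / 2"
    using \<kappa>(1) by (rule order_tendstoD) simp
  ultimately have "\<forall>\<^sub>F i in sequentially. exp (- \<gamma> * real i) * G < 1 / 2 \<and> \<kappa> i < 1 / 2"
    by (rule eventually_conj)
  then obtain i0 where i0: "\<And>i. i \<ge> i0 \<Longrightarrow> exp (- \<gamma> * real i) * G < 1 / 2 \<and> \<kappa> i < 1 / 2"
    by (auto simp: eventually_sequentially)
  define j where "j = Suc i0"
  have "fading u (m + 2 * j) \<le> fading u m / 2" if u: "homogeneous_from m u" for m u
  proof -
    have s0: "fading u m \<ge> 0" by (rule fading_norm_nonneg)
    have "norm (u k) \<le> fading u m / 2" if k: "m + j < k" "k \<le> m + j + j" for k
    proof -
      obtain i where i: "k = m + i" "i \<ge> i0" "i \<ge> 1"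
        using k by (intro that[of "k - m"]) (auto simp: j_def)
      have "norm (u k) \<le> \<kappa> i * fading u m" using \<kappa>(2)[OF u] i by simp
      also have "\<dots> \<le> 1 / 2 * fading u m"
        using i0[of i] i s0 by (intro mult_right_mono) auto
      finally show ?thesis by simp
    qed
    then have step: "fading u (m + j + j) \<le> max (fading u m / 2) (exp (- \<gamma> * real j) * fading u (m + j))"
      using gamma_pos by (intro fading_norm_le) auto
    have "exp (- \<gamma> * real j) * fading u (m + j) \<le> exp (- \<gamma> * real j) * (G * fading u m)"
      by (intro mult_left_mono homogeneous_fading_le u) auto
    also have "\<dots> = exp (- \<gamma> * real j) * G * fading u m"
      by simp
    also have "\<dots> \<le> 1 / 2 * fading u m"
      using i0[of j] s0 by (intro mult_right_mono) (auto simp: j_def)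
    finally show ?thesis using step by (simp add: mult_2 add.assoc)
  qed
  then show ?thesis by (intro exI[of _ "2 * j"]) (auto simp: j_def)
qed

lemma exponential_decay:
  assumes "decaying \<kappa>"
  shows "\<exists>K \<rho>. K \<ge> 0 \<and> 0 \<le> \<rho> \<and> \<rho> < 1 \<and>
    (\<forall>m u i. homogeneous_from m u \<longrightarrow> norm (u (m + i)) \<le> K * \<rho> ^ i * fading u m)"
proof -
  obtain P where P: "P \<ge> 1" "\<And>m u. homogeneous_from m u \<Longrightarrow> fading u (m + P) \<le> fading u m / 2"
    using fading_contraction[OF assms] by blast
  define \<rho> :: real where "\<rho> = (1 / 2) powr (1 / real P)"
  have \<rho>: "0 < \<rho>" "\<rho> < 1"
    using P(1) powr_less_mono2[of "1 / real P" "1 / 2" 1] by (auto simp: \<rho>_def)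
  have \<rho>P: "\<rho> ^ P = 1 / 2"
    using P(1) by (simp add: \<rho>_def powr_realpow[symmetric] powr_powr)
  have multiples: "fading u (m + k * P) \<le> \<rho> ^ (k * P) * fading u m" if u: "homogeneous_from m u" for m u k
  proof (induction k)
    case (Suc k)
    have "fading u (m + k * P + P) \<le> fading u (m + k * P) / 2"
      using homogeneous_from_mono[OF u, of "m + k * P"] by (intro P(2)) simp
    also have "\<dots> \<le> \<rho> ^ (k * P) * fading u m / 2" using Suc by simp
    also have "\<dots> = \<rho> ^ (Suc k * P) * fading u m"
      by (simp add: power_add \<rho>P)
    finally show ?case by (simp add: ac_simps)
  qed simp
  have "norm (u (m + i)) \<le> 2 * G * \<rho> ^ i * fading u m" if u: "homogeneous_from m u" for m u i
  proof -
    define k where "k = i div P"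
    define r where "r = i mod P"
    have i: "i = k * P + r" by (simp add: k_def r_def)
    have "r < P" using P(1) by (simp add: r_def)
    have "norm (u (m + i)) \<le> G * fading u (m + k * P)"
      using homogeneous_from_mono[OF u] by (intro homogeneous_norm_le) (auto simp: i)
    also have "\<dots> \<le> G * (\<rho> ^ (k * P) * fading u m)"
      using G_ge_1 by (intro mult_left_mono multiples u) auto
    also have "\<dots> = G * (\<rho> ^ (k * P) * 1 * fading u m)" by simp
    \<comment> \<open>The \<open>r < P\<close> leftover steps may bring no decay; the factor 2 pays
      for them because \<open>\<rho> ^ P = 1 / 2\<close>.\<close>
    also have "\<dots> \<le> G * (\<rho> ^ (k * P) * (2 * \<rho> ^ r) * fading u m)"
    proof -
      have "\<rho> ^ P \<le> \<rho> ^ r" using \<open>r < P\<close> \<rho> by (intro power_decreasing) auto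
      then have "1 \<le> 2 * \<rho> ^ r" by (simp add: \<rho>P)
      then show ?thesis using G_ge_1 \<rho> fading_norm_nonneg[of \<gamma> u m]
        by (intro mult_left_mono mult_right_mono) auto
    qed
    finally show ?thesis by (simp add: i power_add ac_simps)
  qed
  then show ?thesis using \<rho> G_ge_1 by (intro exI[of _ "2 * G"] exI[of _ \<rho>]) auto
qed

text \<open>Superposition of impulse responses. An impulse at time \<open>k\<close> appears in the
  solution at \<open>Suc k\<close>, alone in its history, and evolves homogeneously from there;
  hence the exponent \<open>n - 1 - k\<close>.\<close>

lemma fv_le_geometric_convolution:
  assumes "decaying \<kappa>"
  shows "\<exists>K \<rho>. K \<ge> 0 \<and> 0 \<le> \<rho> \<and> \<rho> < 1 \<and>
    (\<forall>f n. norm (fv f n) \<le> K * (\<Sum>k<n. \<rho> ^ (n - 1 - k) * norm (f k)))"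
proof -
  obtain K \<rho> where K: "K \<ge> 0" "0 \<le> \<rho>" "\<rho> < 1"
      "\<And>m u i. homogeneous_from m u \<Longrightarrow> norm (u (m + i)) \<le> K * \<rho> ^ i * fading u m"
    using exponential_decay[OF assms] by blast
  have "norm (fv (impulse k v) n) \<le> K * (\<rho> ^ (n - 1 - k) * norm v)" if "k < n" for k n v
  proof -
    define u where "u = fv (impulse k v)"
    have "homogeneous_from (Suc k) u"
      by (auto simp: homogeneous_from_def u_def forward_values_Suc impulse_def)
    moreover have "fading u i = 0" if "i \<le> k" for i
      using that by (induction i) (auto simp: u_def fv_impulse_before simp del: forward_values.simps)
    then have "fading u (Suc k) = norm v"
      by (simp add: u_def fv_impulse_at)
    ultimately show ?thesis
      using K(4)[of "Suc k" u "n - 1 - k"] \<open>k < n\<close> by (simp add: u_def)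
  qed
  then have "norm (fv f n) \<le> K * (\<Sum>k<n. \<rho> ^ (n - 1 - k) * norm (f k))" for f n
    unfolding fv_impulses[of f n] sum_distrib_left by (intro sum_norm_le) auto
  then show ?thesis using K by blast
qed

end

section \<open>Nested sequence spaces and the equivalence of stabilities\<close>

lemma in_lp_finite:
  "p \<noteq> \<infinity> \<Longrightarrow> in_lp p f \<longleftrightarrow> summable (\<lambda>n. norm (f n) powr enn2real p)"
  by (simp add: in_lp_def)

lemma enn2real_ge_1: "1 \<le> p \<Longrightarrow> p \<noteq> \<infinity> \<Longrightarrow> 1 \<le> enn2real p"
  using enn2real_mono[of 1 p] by (simp add: top.not_eq_extremum)

text \<open>Summability makes the norms eventually at most 1, where higher powers are
  smaller.\<close>

lemma in_lp_mono:
  assumes f: "in_lp p f" and pq: "1 \<le> p" "p \<le> q"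
  shows "in_lp q f"
proof (cases "p = \<infinity>")
  case True
  then show ?thesis using f pq by (simp add: top_unique)
next
  case False
  define r where "r = enn2real p"
  have r: "r \<ge> 1" using enn2real_ge_1 pq False by (simp add: r_def)
  have sm: "summable (\<lambda>n. norm (f n) powr r)"
    using f False by (simp add: in_lp_finite r_def)
  have ev: "\<forall>\<^sub>F n in sequentially. norm (f n) \<le> 1"
  proof -
    have "\<forall>\<^sub>F n in sequentially. norm (f n) powr r < 1"
      using summable_LIMSEQ_zero[OF sm] by (rule order_tendstoD) simp
    then show ?thesis
      by (rule eventually_mono) (use r in \<open>meson ge_one_powr_ge_zero less_le_not_le linear order.trans zero_le_one\<close>)
  qed
  show ?thesis
  proof (cases "q = \<infinity>")
    case True
    have "Bseq f" using ev by (intro BfunI)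
    then show ?thesis using True by (simp add: in_lp_def Bseq_eq_bounded)
  next
    case False
    have "r \<le> enn2real q"
      unfolding r_def using pq False by (intro enn2real_mono) (auto simp: top.not_eq_extremum)
    then have "\<forall>\<^sub>F n in sequentially. norm (norm (f n) powr enn2real q) \<le> norm (f n) powr r"
      using ev by (auto elim!: eventually_mono intro: powr_mono')
    then show ?thesis
      using sm False by (auto simp: in_lp_finite intro: summable_comparison_test_ev)
  qed
qed

lemma lp_lq_stable_mono:
  assumes "lp_lq_stable L p q" "1 \<le> p'" "p' \<le> p" "1 \<le> q" "q \<le> q'"
  shows "lp_lq_stable L p' q'"
  using assms in_lp_mono by (fastforce simp: lp_lq_stable_def)

context delay_system
begin

lemma lp_lq_stable_iff: "lp_lq_stable L p q \<longleftrightarrow> (\<forall>f. in_lp p f \<longrightarrow> in_lp q (fv f))"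
  by (simp add: lp_lq_stable_def zero_state_solution_nat)

text \<open>\<open>(1, \<infinity>)\<close> is the weakest of all pairs, so it is available from any
  of them. It yields \<open>C\<close>, and together with the tail hypothesis
  \<open>M\<close>.\<close>

lemma uniform_of_stable:
  assumes "lp_lq_stable L p q" "1 \<le> p" "p \<le> q"
    and tail: "bdd_above (range (\<lambda>n. operator_norm \<gamma> (\<lambda>\<phi>. L n (tail_projection m \<phi>))))"
  shows "\<exists>C M. uniform_delay_system \<gamma> L C M"
proof -
  have "lp_lq_stable L 1 \<infinity>"
    using assms by (intro lp_lq_stable_mono[OF assms(1)]) auto
  then have "bounded (range (fv f))" if "summable (\<lambda>n. norm (f n) powr 1)" for f
    using that by (auto simp: lp_lq_stable_iff in_lp_def)
  then obtain C where C: "C \<ge> 0" "\<And>f n. norm (fv f n) \<le> C * (\<Sum>k<n. norm (f k) powr 1) powr (1 / 1)"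
    using sup_bound_of_stability[of 1] by auto
  have C': "norm (fv f n) \<le> C * (\<Sum>k<n. norm (f k))" for f n
    using C(2)[of f n] by (simp add: sum_nonneg)
  obtain M where M: "M \<ge> 0" "\<And>n \<phi> c. (\<forall>j. norm (\<phi> j) \<le> c * exp (\<gamma> * real j)) \<Longrightarrow> (\<forall>j\<ge>n. \<phi> j = 0) \<Longrightarrow>
      norm (L n \<phi>) \<le> M * c"
    using L_uniform_bound[OF C' C(1) tail] by blast
  have "uniform_delay_system \<gamma> L C M"
    by unfold_locales (use C(1) C' M in auto)
  then show ?thesis by blast
qed

end

context uniform_delay_system
begin

lemma decaying_of_stable:
  assumes st: "lp_lq_stable L p q" and pq: "1 \<le> p" "p \<le> q" "(p, q) \<noteq> (1, \<infinity>)"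
  shows "\<exists>\<kappa>. decaying \<kappa>"
proof (cases "q = \<infinity>")
  case False
  define r where "r = enn2real q"
  have r: "r \<ge> 1" using enn2real_ge_1[of q] pq False by (simp add: r_def)
  have "lp_lq_stable L 1 q"
    using pq by (intro lp_lq_stable_mono[OF st]) auto
  then have "summable (\<lambda>n. norm (fv f n) powr r)" if "summable (\<lambda>n. norm (f n))" for f
    using that False by (auto simp: lp_lq_stable_iff in_lp_def r_def)
  then show ?thesis
    using power_bound_of_stability[OF r] decaying_of_power_bound[OF r] by blast
next
  case True
  \<comment> \<open>With \<open>q = \<infinity>\<close>, excluding \<open>(1, \<infinity>)\<close>
    leaves \<open>p > 1\<close>. The ramp argument needs a finite exponent, so
    \<open>p = \<infinity>\<close> is lowered to 2.\<close>
  obtain r where r: "r > 1" "lp_lq_stable L (ennreal r) \<infinity>"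
  proof (cases "p = \<infinity>")
    case True
    then show ?thesis
      using lp_lq_stable_mono[OF st, of 2 \<infinity>] \<open>q = \<infinity>\<close> by (intro that[of 2]) auto
  next
    case False
    then have "enn2real p \<noteq> 1" using pq True by (metis ennreal_1 ennreal_enn2real less_top infinity_ennreal_def)
    then have "1 < enn2real p" using enn2real_ge_1[OF pq(1) False] by linarith
    then show ?thesis
      using st True False
      by (intro that[of "enn2real p"]) (auto simp: less_top)
  qed
  have "bounded (range (fv f))" if "summable (\<lambda>n. norm (f n) powr r)" for f
    using that r by (auto simp: lp_lq_stable_iff in_lp_def)
  then show ?thesis
    using sup_bound_of_stability[of r] decaying_of_sup_bound[of r] r(1) by (metis less_imp_le)
qed

lemma stable_of_decaying:
  assumes "decaying \<kappa>" and pq: "1 \<le> p" "p \<le> q"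
  shows "lp_lq_stable L p q"
proof -
  obtain K \<rho> where K: "K \<ge> 0" "0 \<le> \<rho>" "\<rho> < 1"
      "\<And>f n. norm (fv f n) \<le> K * (\<Sum>k<n. \<rho> ^ (n - 1 - k) * norm (f k))"
    using fv_le_geometric_convolution[OF assms(1)] by blast
  have "in_lp p (fv f)" if f: "in_lp p f" for f
  proof (cases "p = \<infinity>")
    case True
    then obtain B where B: "\<And>n. norm (f n) \<le> B" "B > 0"
      using f by (auto simp: in_lp_def bounded_pos)
    have "norm (fv f n) \<le> K * (B / (1 - \<rho>))" for n
      using K(4)[of f n] mult_left_mono[OF bounded_geometric_convolution[OF K(2,3) B(1)] K(1)] B(2)
      by (meson less_imp_le order_trans)
    then show ?thesis using True by (auto simp: in_lp_def bounded_iff)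
  next
    case False
    define r where "r = enn2real p"
    have r: "r \<ge> 1" using enn2real_ge_1 pq False by (simp add: r_def)
    define b where "b = (\<lambda>n. \<Sum>k<n. \<rho> ^ (n - 1 - k) * norm (f k))"
    have b0: "b n \<ge> 0" for n unfolding b_def using K by (intro sum_nonneg) auto
    have "summable (\<lambda>n. b n powr r)"
      unfolding b_def using f False K r
      by (intro summable_geometric_convolution) (auto simp: in_lp_finite r_def)
    then have "summable (\<lambda>n. K powr r * b n powr r)" by (rule summable_mult)
    then have "summable (\<lambda>n. norm (fv f n) powr r)"
    proof (rule summable_comparison_test')
      show "norm (norm (fv f n) powr r) \<le> K powr r * b n powr r" for n
        using powr_mono2[OF _ norm_ge_zero K(4)[of f n], of r] r K(1) b0[of n]
        by (simp add: powr_mult b_def)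
    qed
    then show ?thesis using False by (simp add: in_lp_finite r_def)
  qed
  then show ?thesis
    using in_lp_mono[OF _ pq] by (auto simp: lp_lq_stable_iff)
qed

end

theorem corollary3p4:
  fixes \<gamma> :: real
    and L :: "nat \<Rightarrow> (nat \<Rightarrow> 'a::banach) \<Rightarrow> 'a"
  assumes "\<gamma> > 0"
    and "\<And>n. bounded_operator \<gamma> (L n)"
    and "\<exists>m::int. m \<le> 0 \<and>
           bdd_above (range (\<lambda>n. operator_norm \<gamma> (\<lambda>\<phi>. L n (tail_projection m \<phi>))))"
    and "\<exists>p q. 1 \<le> p \<and> p \<le> q \<and> (p, q) \<noteq> (1, \<infinity>) \<and> lp_lq_stable L p q"
  shows "\<forall>p q. 1 \<le> p \<and> p \<le> q \<and> (p, q) \<noteq> (1, \<infinity>) \<longrightarrow> lp_lq_stable L p q"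
proof -
  interpret delay_system \<gamma> L
    by unfold_locales (use assms(1,2) in auto)
  obtain p q where pq: "1 \<le> p" "p \<le> q" "(p, q) \<noteq> (1, \<infinity>)" "lp_lq_stable L p q"
    using assms(4) by blast
  obtain C M where "uniform_delay_system \<gamma> L C M"
    using assms(3) uniform_of_stable[OF pq(4,1,2)] by blast
  then interpret uniform_delay_system \<gamma> L C M .
  show ?thesis
    using decaying_of_stable[OF pq(4,1-3)] stable_of_decaying by blast
qed

end
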